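(* If $n$ is a powerful positive integer, then there exists a Bieberbach group $G$ with generalized exponent $\exp_{\bullet}(G)=n$.
   Context: A positive integer $n$ is powerful if for every prime $p$, $p\mid n$ implies $p^2\mid n$. A $d$-dimensional crystallographic group is a discrete and cocompact subgroup of $\operatorname{Iso}(\mathbb{R}^d)=O(d)\ltimes\mathbb{R}^d$, the isometry group of $d$-dimensional Euclidean space; a Bieberbach group is a torsion-free crystallographic group of some dimension $d\ge0$ (dimension $0$ giving the trivial group). For $x,y$ in a group and a conjugacy class $C$ of a group $G$ and $k\ge1$, put $C^k=\{c_1\cdots c_k\mid c_i\in C\}$. The generalized exponent $\exp_{\bullet}(G)$ is the smallest positive integer $k$ such that $1\in C^k$ for all conjugacy classes $C$ of $G$ (if such a $k$ exists). *)

theory Defs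
  imports
    "HOL-Computational_Algebra.Primes"
    "HOL-Algebra.Coset"
    "HOL-Analysis.Function_Topology"
    "Jordan_Normal_Form.Determinant"
begin

definition powerful :: "nat \<Rightarrow> bool" where
  "powerful n \<longleftrightarrow> 0 < n \<and> (\<forall>p. prime p \<longrightarrow> p dvd n \<longrightarrow> p\<^sup>2 dvd n)"


section \<open>The isometry group of Euclidean space\<close>

definition orthogonal_matrices :: "nat \<Rightarrow> real mat set" where
  "orthogonal_matrices d = {A \<in> carrier_mat d d. transpose_mat A * A = 1\<^sub>m d}"

text \<open>The pair \<open>(A, v)\<close> stands for the isometry \<open>x \<mapsto> A x + v\<close>, so that multiplication in the
  semidirect product is composition of maps.\<close>

type_synonym euclidean_motion = "real mat \<times> real vec"

definition Iso :: "nat \<Rightarrow> euclidean_motion monoid" where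
  "Iso d = \<lparr>carrier = orthogonal_matrices d \<times> carrier_vec d,
            monoid.mult = (\<lambda>(A, v) (B, w). (A * B, A *\<^sub>v w + v)),
            monoid.one = (1\<^sub>m d, 0\<^sub>v d)\<rparr>"

lemma orthogonal_matrices_right_inverse:
  assumes "A \<in> orthogonal_matrices d"
  shows "A * transpose_mat A = 1\<^sub>m d"
  using assms mat_mult_left_right_inverse[of "transpose_mat A" d A]
  by (auto simp: orthogonal_matrices_def)

lemma group_Iso: "group (Iso d)"
proof (rule groupI)
  fix x y assume "x \<in> carrier (Iso d)" "y \<in> carrier (Iso d)"
  then obtain A v B w where x: "x = (A, v)" "y = (B, w)"
    and c: "A \<in> carrier_mat d d" "B \<in> carrier_mat d d" "v \<in> carrier_vec d" "w \<in> carrier_vec d"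
    and o: "transpose_mat A * A = 1\<^sub>m d" "transpose_mat B * B = 1\<^sub>m d"
    by (auto simp: Iso_def orthogonal_matrices_def)
  have "transpose_mat (A * B) * (A * B) = transpose_mat B * ((transpose_mat A * A) * B)"
    using c by (simp add: transpose_mult assoc_mult_mat[of _ d d _ d _ d])
  also have "\<dots> = 1\<^sub>m d" using c o by simp
  finally show "x \<otimes>\<^bsub>Iso d\<^esub> y \<in> carrier (Iso d)"
    using c x by (auto simp: Iso_def orthogonal_matrices_def)
next
  show "\<one>\<^bsub>Iso d\<^esub> \<in> carrier (Iso d)"
    by (auto simp: Iso_def orthogonal_matrices_def)
next
  fix x y z assume "x \<in> carrier (Iso d)" "y \<in> carrier (Iso d)" "z \<in> carrier (Iso d)"
  then obtain A v B w C u where x: "x = (A, v)" "y = (B, w)" "z = (C, u)"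
    and c: "A \<in> carrier_mat d d" "B \<in> carrier_mat d d" "C \<in> carrier_mat d d"
      "v \<in> carrier_vec d" "w \<in> carrier_vec d" "u \<in> carrier_vec d"
    by (auto simp: Iso_def orthogonal_matrices_def)
  show "x \<otimes>\<^bsub>Iso d\<^esub> y \<otimes>\<^bsub>Iso d\<^esub> z = x \<otimes>\<^bsub>Iso d\<^esub> (y \<otimes>\<^bsub>Iso d\<^esub> z)"
    using c x by (simp add: Iso_def mult_add_distrib_mat_vec[of _ d d]
        assoc_mult_mat[of _ d d _ d _ d] assoc_mult_mat_vec[of _ d d _ d]
        assoc_add_vec[of _ d])
next
  fix x assume "x \<in> carrier (Iso d)"
  then show "\<one>\<^bsub>Iso d\<^esub> \<otimes>\<^bsub>Iso d\<^esub> x = x"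
    by (auto simp: Iso_def orthogonal_matrices_def)
next
  fix x assume "x \<in> carrier (Iso d)"
  then obtain A v where x: "x = (A, v)" and A: "A \<in> orthogonal_matrices d"
    and c: "A \<in> carrier_mat d d" "v \<in> carrier_vec d"
    by (auto simp: Iso_def orthogonal_matrices_def)
  have "(transpose_mat A, - (transpose_mat A *\<^sub>v v)) \<in> carrier (Iso d)"
    using A c orthogonal_matrices_right_inverse[OF A]
    by (auto simp: Iso_def orthogonal_matrices_def)
  moreover have "(transpose_mat A, - (transpose_mat A *\<^sub>v v)) \<otimes>\<^bsub>Iso d\<^esub> x = \<one>\<^bsub>Iso d\<^esub>"
    using A c x by (auto simp: Iso_def orthogonal_matrices_def)
  ultimately show "\<exists>y\<in>carrier (Iso d). y \<otimes>\<^bsub>Iso d\<^esub> x = \<one>\<^bsub>Iso d\<^esub>" by blast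
qed

text \<open>The topology is the one of matrix and vector entries. Entries outside the \<open>d\<close>-dimensional
  range are replaced by \<open>0\<close>, so only genuine coordinates matter.\<close>

definition motion_coords ::
  "nat \<Rightarrow> euclidean_motion \<Rightarrow> (nat \<times> nat \<Rightarrow> real) \<times> (nat \<Rightarrow> real)" where
  "motion_coords d = (\<lambda>(A, v).
     (\<lambda>(i, j). if i < d \<and> j < d then A $$ (i, j) else 0, \<lambda>i. if i < d then v $ i else 0))"

definition Iso_topology :: "nat \<Rightarrow> euclidean_motion topology" where
  "Iso_topology d = pullback_topology (carrier (Iso d)) (motion_coords d) euclidean"

lemma topspace_Iso_topology [simp]: "topspace (Iso_topology d) = carrier (Iso d)"
  by (simp add: Iso_topology_def topspace_pullback_topology)


section \<open>Crystallographic and Bieberbach groups\<close>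

text \<open>The quotient topology on the space of cosets \<open>H g\<close>.\<close>

definition coset_topology :: "nat \<Rightarrow> euclidean_motion set \<Rightarrow> euclidean_motion set topology" where
  "coset_topology d H = topology (\<lambda>U. U \<subseteq> rcosets\<^bsub>Iso d\<^esub> H \<and>
     openin (Iso_topology d) {g \<in> carrier (Iso d). H #>\<^bsub>Iso d\<^esub> g \<in> U})"

lemma openin_coset_topology:
  "openin (coset_topology d H) U \<longleftrightarrow> U \<subseteq> rcosets\<^bsub>Iso d\<^esub> H \<and>
     openin (Iso_topology d) {g \<in> carrier (Iso d). H #>\<^bsub>Iso d\<^esub> g \<in> U}"
proof -
  have inter: "{g \<in> carrier (Iso d). H #>\<^bsub>Iso d\<^esub> g \<in> S \<inter> T} =
      {g \<in> carrier (Iso d). H #>\<^bsub>Iso d\<^esub> g \<in> S} \<inter> {g \<in> carrier (Iso d). H #>\<^bsub>Iso d\<^esub> g \<in> T}"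
    for S T by auto
  have union: "{g \<in> carrier (Iso d). H #>\<^bsub>Iso d\<^esub> g \<in> \<Union>K} =
      (\<Union>S\<in>K. {g \<in> carrier (Iso d). H #>\<^bsub>Iso d\<^esub> g \<in> S})" for K by auto
  have "istopology (\<lambda>U. U \<subseteq> rcosets\<^bsub>Iso d\<^esub> H \<and>
      openin (Iso_topology d) {g \<in> carrier (Iso d). H #>\<^bsub>Iso d\<^esub> g \<in> U})"
    unfolding istopology_def inter union by (auto intro!: openin_Int openin_Union)
  then show ?thesis
    by (simp add: coset_topology_def topology_inverse')
qed

lemma quotient_map_coset_topology:
  "quotient_map (Iso_topology d) (coset_topology d H) (\<lambda>g. H #>\<^bsub>Iso d\<^esub> g)"
proof -
  have "openin (coset_topology d H) (rcosets\<^bsub>Iso d\<^esub> H)"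
    using openin_topspace[of "Iso_topology d"]
    by (auto simp: openin_coset_topology RCOSETS_def elim!: back_subst[of "openin _"])
  then have "topspace (coset_topology d H) = rcosets\<^bsub>Iso d\<^esub> H"
    by (metis openin_coset_topology openin_subset openin_topspace subset_antisym)
  then show ?thesis
    by (auto simp: quotient_map_def openin_coset_topology RCOSETS_def)
qed

definition crystallographic :: "nat \<Rightarrow> euclidean_motion set \<Rightarrow> bool" where
  "crystallographic d H \<longleftrightarrow> subgroup H (Iso d) \<and>
     subtopology (Iso_topology d) H = discrete_topology H \<and>
     compact_space (coset_topology d H)"

definition torsion_free :: "('a, 'b) monoid_scheme \<Rightarrow> bool" where
  "torsion_free G \<longleftrightarrow>
     (\<forall>g\<in>carrier G. \<forall>k::nat. 0 < k \<longrightarrow> g [^]\<^bsub>G\<^esub> k = \<one>\<^bsub>G\<^esub> \<longrightarrow> g = \<one>\<^bsub>G\<^esub>)"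

definition Bieberbach :: "euclidean_motion monoid \<Rightarrow> bool" where
  "Bieberbach G \<longleftrightarrow>
     (\<exists>d H. crystallographic d H \<and> G = (Iso d)\<lparr>carrier := H\<rparr> \<and> torsion_free G)"


section \<open>The generalized exponent\<close>

definition conjugacy_class :: "('a, 'b) monoid_scheme \<Rightarrow> 'a \<Rightarrow> 'a set" where
  "conjugacy_class G x = {g \<otimes>\<^bsub>G\<^esub> x \<otimes>\<^bsub>G\<^esub> inv\<^bsub>G\<^esub> g |g. g \<in> carrier G}"

definition conjugacy_classes :: "('a, 'b) monoid_scheme \<Rightarrow> 'a set set" where
  "conjugacy_classes G = conjugacy_class G ` carrier G"

definition set_power :: "('a, 'b) monoid_scheme \<Rightarrow> 'a set \<Rightarrow> nat \<Rightarrow> 'a set" where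
  "set_power G C k = {foldr (\<otimes>\<^bsub>G\<^esub>) cs \<one>\<^bsub>G\<^esub> |cs. length cs = k \<and> set cs \<subseteq> C}"

definition annihilates_classes :: "('a, 'b) monoid_scheme \<Rightarrow> nat \<Rightarrow> bool" where
  "annihilates_classes G k \<longleftrightarrow>
     0 < k \<and> (\<forall>C\<in>conjugacy_classes G. \<one>\<^bsub>G\<^esub> \<in> set_power G C k)"

text \<open>The value \<open>0\<close> encodes that the generalized exponent does not exist.\<close>

definition generalized_exponent :: "('a, 'b) monoid_scheme \<Rightarrow> nat" where
  "generalized_exponent G =
     (if \<exists>k. annihilates_classes G k then LEAST k. annihilates_classes G k else 0)"

end

theory Submission
  imports
    Defs
    "HOL-Algebra.Elementary_Groups"
    "HOL-Algebra.Multiplicative_Group"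
begin

text \<open>Write \<open>n = m r\<close> with \<open>r\<close> dividing \<open>m\<close> and every prime divisor of \<open>m\<close> dividing \<open>r\<close>. The group acts
  on the real functions \<open>y\<close> on \<open>{0..m} \<times> \<int>/r\<close> with zero sum over each fibre \<open>{j} \<times> \<int>/r\<close>. Its holonomy is
  \<open>\<int>/m \<times> \<int>/r\<close>: the pair \<open>(a, b)\<close> rotates the fibres over \<open>{0..<m}\<close> by \<open>a\<close> and turns each of them by
  \<open>b\<close>, and it turns the last fibre by \<open>a\<close>. The translation parts lie in \<open>1/r \<int>\<close> and are constant
  modulo \<open>\<int>\<close> on fibres: on the last one they are \<open>b/r\<close>, on the others they count the carries of
  adding \<open>a\<close> modulo \<open>m\<close>. Through the carries, \<open>a\<close> is well defined modulo \<open>n\<close>, so the group maps onto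
  \<open>\<int>/n\<close> and \<open>n\<close> divides every exponent. Conversely, let \<open>q\<close> be the order of the holonomy of \<open>g\<close>. The
  product of the conjugates of \<open>g\<^sup>q\<close> by representatives of the holonomy group modulo the holonomy of
  \<open>g\<close> is a translation invariant under the holonomy, hence trivial, and it consists of \<open>q (n / q) = n\<close>
  conjugates of \<open>g\<close>.\<close>


section \<open>Permutations in orthonormal coordinates\<close>

lemma mat_eq_by_action:
  fixes A B :: "'a::comm_ring_1 mat"
  assumes A: "A \<in> carrier_mat k l" and B: "B \<in> carrier_mat k l"
    and eq: "\<And>v. v \<in> carrier_vec l \<Longrightarrow> A *\<^sub>v v = B *\<^sub>v v"
  shows "A = B"
proof (rule eq_matI)
  fix i j assume "i < dim_row B" "j < dim_col B"
  then have ij: "i < k" "j < l" using B by auto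
  have "(M *\<^sub>v unit_vec l j) $ i = M $$ (i, j)" if "M \<in> carrier_mat k l" for M :: "'a mat"
    using that ij by (simp add: scalar_prod_right_unit)
  with A B eq[of "unit_vec l j"] show "A $$ (i, j) = B $$ (i, j)"
    by (metis unit_vec_carrier)
qed (use A B in auto)

text \<open>The \<open>e \<alpha>\<close> identify a subspace of the real functions on
  \<open>X\<close> isometrically with Euclidean space of dimension \<open>d\<close>, so that
  permutations of \<open>X\<close> preserving the subspace become orthogonal matrices.\<close>

locale orthonormal_frame =
  fixes X :: "'x set" and d :: nat and e :: "nat \<Rightarrow> 'x \<Rightarrow> real"
  assumes finite_X: "finite X"
    and orthonormal: "\<And>\<alpha> \<beta>. \<alpha> < d \<Longrightarrow> \<beta> < d \<Longrightarrow>
      (\<Sum>x\<in>X. e \<alpha> x * e \<beta> x) = (if \<alpha> = \<beta> then 1 else 0)"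
begin

definition coords :: "('x \<Rightarrow> real) \<Rightarrow> real vec" where
  "coords y = vec d (\<lambda>\<alpha>. \<Sum>x\<in>X. e \<alpha> x * y x)"

definition synth :: "real vec \<Rightarrow> 'x \<Rightarrow> real" where
  "synth v x = (\<Sum>\<alpha><d. v $ \<alpha> * e \<alpha> x)"

text \<open>\<open>synth\<close> after \<open>coords\<close> is the orthogonal projection onto the
  span of the frame; only values on \<open>X\<close> count.\<close>

definition spanned :: "('x \<Rightarrow> real) \<Rightarrow> bool" where
  "spanned y \<longleftrightarrow> (\<forall>x\<in>X. synth (coords y) x = y x)"

text \<open>The matrix of \<open>y \<mapsto> y \<circ> \<sigma>\<close> followed by the projection
  onto the span.\<close>

definition compose_mat :: "('x \<Rightarrow> 'x) \<Rightarrow> real mat" where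
  "compose_mat \<sigma> = mat d d (\<lambda>(\<alpha>, \<beta>). \<Sum>x\<in>X. e \<alpha> x * e \<beta> (\<sigma> x))"

lemma coords_carrier [simp]: "coords y \<in> carrier_vec d"
  by (simp add: coords_def)

lemma compose_mat_carrier [simp]: "compose_mat \<sigma> \<in> carrier_mat d d"
  by (simp add: compose_mat_def)

lemma coords_cong: "(\<And>x. x \<in> X \<Longrightarrow> y x = z x) \<Longrightarrow> coords y = coords z"
  by (simp add: coords_def cong: sum.cong)

lemma compose_mat_cong: "(\<And>x. x \<in> X \<Longrightarrow> \<sigma> x = \<tau> x) \<Longrightarrow> compose_mat \<sigma> = compose_mat \<tau>"
  by (simp add: compose_mat_def cong: sum.cong)

lemma coords_add: "coords (\<lambda>x. y x + z x) = coords y + coords z"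
  by (rule eq_vecI) (auto simp: coords_def sum.distrib algebra_simps)

lemma coords_synth:
  assumes "v \<in> carrier_vec d"
  shows "coords (synth v) = v"
proof (rule eq_vecI)
  fix \<alpha> assume "\<alpha> < dim_vec v"
  then have \<alpha>: "\<alpha> < d" using assms by auto
  have "(\<Sum>x\<in>X. e \<alpha> x * synth v x) = (\<Sum>x\<in>X. \<Sum>\<beta><d. v $ \<beta> * (e \<alpha> x * e \<beta> x))"
    by (simp add: synth_def sum_distrib_left mult.left_commute)
  also have "\<dots> = (\<Sum>\<beta><d. v $ \<beta> * (\<Sum>x\<in>X. e \<alpha> x * e \<beta> x))"
    by (subst sum.swap) (simp add: sum_distrib_left)
  also have "\<dots> = (\<Sum>\<beta><d. if \<alpha> = \<beta> then v $ \<beta> else 0)"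
    using \<alpha> by (intro sum.cong) (auto simp: orthonormal)
  also have "\<dots> = v $ \<alpha>" using \<alpha> by simp
  finally show "coords (synth v) $ \<alpha> = v $ \<alpha>" using \<alpha> by (simp add: coords_def)
qed (use assms in \<open>simp add: coords_def\<close>)

lemma spanned_synth: "v \<in> carrier_vec d \<Longrightarrow> spanned (synth v)"
  by (simp add: spanned_def coords_synth)

lemma coords_eqD:
  assumes "coords y = coords z" "spanned y" "spanned z" "x \<in> X"
  shows "y x = z x"
  using assms by (metis spanned_def)

lemma compose_mat_mult_vec:
  assumes "v \<in> carrier_vec d"
  shows "compose_mat \<sigma> *\<^sub>v v = coords (\<lambda>x. synth v (\<sigma> x))"
proof (rule eq_vecI)
  fix \<alpha> assume "\<alpha> < dim_vec (coords (\<lambda>x. synth v (\<sigma> x)))"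
  then have \<alpha>: "\<alpha> < d" by (simp add: coords_def)
  have "(compose_mat \<sigma> *\<^sub>v v) $ \<alpha> = (\<Sum>\<beta><d. (\<Sum>x\<in>X. e \<alpha> x * e \<beta> (\<sigma> x)) * v $ \<beta>)"
    using \<alpha> assms by (simp add: compose_mat_def scalar_prod_def lessThan_atLeast0)
  also have "\<dots> = (\<Sum>x\<in>X. e \<alpha> x * synth v (\<sigma> x))"
    by (simp add: synth_def sum_distrib_left sum_distrib_right mult_ac sum.swap[of _ X])
  finally show "(compose_mat \<sigma> *\<^sub>v v) $ \<alpha> = coords (\<lambda>x. synth v (\<sigma> x)) $ \<alpha>"
    using \<alpha> by (simp add: coords_def)
qed (simp add: coords_def compose_mat_def)

lemma compose_mat_mult_coords:
  assumes "\<sigma> ` X \<subseteq> X" "spanned y"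
  shows "compose_mat \<sigma> *\<^sub>v coords y = coords (\<lambda>x. y (\<sigma> x))"
proof -
  have "synth (coords y) (\<sigma> x) = y (\<sigma> x)" if "x \<in> X" for x
    using assms that by (auto simp: spanned_def)
  then show ?thesis by (simp add: compose_mat_mult_vec cong: coords_cong)
qed

text \<open>The projection between the two factors is harmless because composing with
  \<open>\<tau>\<close> does not leave the span. Precomposition is contravariant, so the maps
  compose in reversed order.\<close>

lemma compose_mat_mult:
  assumes "\<sigma> ` X \<subseteq> X" and "\<And>y. spanned y \<Longrightarrow> spanned (\<lambda>x. y (\<tau> x))"
  shows "compose_mat \<sigma> * compose_mat \<tau> = compose_mat (\<lambda>x. \<tau> (\<sigma> x))"
proof (rule mat_eq_by_action[of _ d d])
  fix v :: "real vec" assume v: "v \<in> carrier_vec d"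
  have "(compose_mat \<sigma> * compose_mat \<tau>) *\<^sub>v v = compose_mat \<sigma> *\<^sub>v (compose_mat \<tau> *\<^sub>v v)"
    using v by (simp add: assoc_mult_mat_vec[of _ d d _ d])
  also have "\<dots> = coords (\<lambda>x. synth v (\<tau> (\<sigma> x)))"
    using v by (simp add: compose_mat_mult_vec[of v] compose_mat_mult_coords assms spanned_synth)
  finally show "(compose_mat \<sigma> * compose_mat \<tau>) *\<^sub>v v = compose_mat (\<lambda>x. \<tau> (\<sigma> x)) *\<^sub>v v"
    using v by (simp add: compose_mat_mult_vec)
qed (simp_all add: mult_carrier_mat[of _ d d])

lemma compose_mat_ident:
  assumes "\<And>x. x \<in> X \<Longrightarrow> \<sigma> x = x"
  shows "compose_mat \<sigma> = 1\<^sub>m d"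
  by (rule eq_matI) (auto simp: compose_mat_def orthonormal assms cong: sum.cong)

text \<open>Reindexing the sum along \<open>\<sigma>\<close> moves the permutation to the other
  frame vector as its inverse.\<close>

lemma compose_mat_transpose:
  assumes "bij_betw \<sigma> X X" and "\<And>x. x \<in> X \<Longrightarrow> \<tau> (\<sigma> x) = x"
  shows "transpose_mat (compose_mat \<sigma>) = compose_mat \<tau>"
proof (rule eq_matI)
  fix \<alpha> \<beta> assume "\<alpha> < dim_row (compose_mat \<tau>)" "\<beta> < dim_col (compose_mat \<tau>)"
  then have l: "\<alpha> < d" "\<beta> < d" by (auto simp: compose_mat_def)
  have "(\<Sum>x\<in>X. e \<beta> x * e \<alpha> (\<sigma> x)) = (\<Sum>x\<in>X. e \<alpha> (\<sigma> x) * e \<beta> (\<tau> (\<sigma> x)))"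
    by (intro sum.cong) (auto simp: assms)
  also have "\<dots> = (\<Sum>x\<in>X. e \<alpha> x * e \<beta> (\<tau> x))"
    by (rule sum.reindex_bij_betw[OF assms(1)])
  finally show "transpose_mat (compose_mat \<sigma>) $$ (\<alpha>, \<beta>) = compose_mat \<tau> $$ (\<alpha>, \<beta>)"
    using l by (simp add: compose_mat_def)
qed (auto simp: compose_mat_def)

end


section \<open>A criterion for crystallographic groups\<close>

text \<open>Open sets of the pullback are traces of preimages, so an open cover of \<open>K\<close>
  comes from one of the image of \<open>K\<close>.\<close>

lemma compactin_pullback_topology:
  fixes f :: "'a \<Rightarrow> 'b::topological_space"
  assumes "K \<subseteq> A" "compact (f ` K)"
  shows "compactin (pullback_topology A f euclidean) K"
  unfolding compactin_def
proof (intro conjI allI impI)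
  show "K \<subseteq> topspace (pullback_topology A f euclidean)"
    using assms by (simp add: topspace_pullback_topology)
  fix \<U> assume \<U>: "Ball \<U> (openin (pullback_topology A f euclidean)) \<and> K \<subseteq> \<Union>\<U>"
  then have "\<forall>U\<in>\<U>. \<exists>V. open V \<and> U = f -` V \<inter> A"
    by (auto simp: openin_pullback_topology)
  then obtain V where V: "\<And>U. U \<in> \<U> \<Longrightarrow> open (V U) \<and> U = f -` V U \<inter> A" by metis
  have "f ` K \<subseteq> (\<Union>U\<in>\<U>. V U)" using V \<U> by fastforce
  then obtain \<F> where \<F>: "\<F> \<subseteq> \<U>" "finite \<F>" "f ` K \<subseteq> (\<Union>U\<in>\<F>. V U)"
    using compactE_image[OF assms(2), of \<U> V] V by auto
  have "K \<subseteq> \<Union>\<F>"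
  proof
    fix x assume x: "x \<in> K"
    then obtain U where "U \<in> \<F>" "f x \<in> V U" using \<F> by auto
    moreover from this have "U = f -` V U \<inter> A" using V \<F> by blast
    ultimately show "x \<in> \<Union>\<F>" using x assms(1) by blast
  qed
  with \<F> show "\<exists>\<F>. finite \<F> \<and> \<F> \<subseteq> \<U> \<and> K \<subseteq> \<Union>\<F>" by blast
qed

text \<open>Tychonoff's theorem, transferred to the topology of the function type.\<close>

lemma compact_PiE_UNIV:
  fixes S :: "'a \<Rightarrow> 'b::topological_space set"
  assumes "\<And>i. compact (S i)"
  shows "compact (Pi UNIV S)"
proof -
  have "compactin (product_topology (\<lambda>i. euclidean) UNIV) (PiE UNIV S)"
    using assms by (simp add: compactin_PiE)
  then show ?thesis
    by (simp add: euclidean_product_topology PiE_UNIV_domain)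
qed

lemma orthogonal_matrices_iff_sum:
  assumes "A \<in> carrier_mat d d"
  shows "A \<in> orthogonal_matrices d \<longleftrightarrow>
    (\<forall>i<d. \<forall>j<d. (\<Sum>k<d. A $$ (k, i) * A $$ (k, j)) = (if i = j then 1 else 0))"
proof -
  have "(transpose_mat A * A) $$ (i, j) = (\<Sum>k<d. A $$ (k, i) * A $$ (k, j))"
    if "i < d" "j < d" for i j
    using that assms by (simp add: scalar_prod_def lessThan_atLeast0)
  moreover have "transpose_mat A * A = 1\<^sub>m d \<longleftrightarrow>
      (\<forall>i<d. \<forall>j<d. (transpose_mat A * A) $$ (i, j) = (1\<^sub>m d :: real mat) $$ (i, j))"
    using assms by (auto simp: mat_eq_iff)
  ultimately show ?thesis
    using assms by (auto simp: orthogonal_matrices_def)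
qed

text \<open>In coordinates the set is a product of compact intervals, with the closed orthogonality
  relations imposed on the matrix part.\<close>

lemma compactin_motions_bounded:
  "compactin (Iso_topology d) {(A, v) \<in> carrier (Iso d). \<forall>i<d. \<bar>v $ i\<bar> \<le> M}"
    (is "compactin _ ?K")
  unfolding Iso_topology_def
proof (rule compactin_pullback_topology)
  show "?K \<subseteq> carrier (Iso d)" by auto
  define P :: "(nat \<times> nat \<Rightarrow> real) set" where
    "P = Pi UNIV (\<lambda>(i, j). if i < d \<and> j < d then {-1..1} else {0})"
  define Q :: "(nat \<Rightarrow> real) set" where
    "Q = Pi UNIV (\<lambda>i. if i < d then {-M..M} else {0})"
  define E :: "(nat \<times> nat \<Rightarrow> real) set" where
    "E = {a. \<forall>i<d. \<forall>j<d. (\<Sum>k<d. a (k, i) * a (k, j)) = (if i = j then 1 else 0)}"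
  have "closed E"
  proof -
    have E: "E = (\<Inter>i\<in>{..<d}. \<Inter>j\<in>{..<d}.
        {a. (\<Sum>k<d. a (k, i) * a (k, j)) = (if i = j then 1 else 0)})"
      by (auto simp: E_def)
    show ?thesis unfolding E
      by (intro closed_INT ballI closed_Collect_eq continuous_intros
          continuous_on_product_coordinates)
  qed
  moreover have "compact P" "compact Q"
    unfolding P_def Q_def by (intro compact_PiE_UNIV; auto split: prod.split)+
  ultimately have c: "compact ((P \<inter> E) \<times> Q)"
    by (intro compact_Times compact_Int_closed)
  have "motion_coords d ` ?K = (P \<inter> E) \<times> Q"
  proof (intro subset_antisym subsetI)
    fix z assume "z \<in> motion_coords d ` ?K"
    then obtain A v where z: "z = motion_coords d (A, v)" and A: "A \<in> orthogonal_matrices d"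
      and v: "v \<in> carrier_vec d" "\<forall>i<d. \<bar>v $ i\<bar> \<le> M"
      by (auto simp: Iso_def)
    then have s: "\<forall>i<d. \<forall>j<d. (\<Sum>k<d. A $$ (k, i) * A $$ (k, j)) = (if i = j then 1 else 0)"
      using orthogonal_matrices_iff_sum[of A d] by (auto simp: orthogonal_matrices_def)
    \<comment> \<open>The columns are unit vectors, which bounds every entry.\<close>
    have "\<bar>A $$ (k, i)\<bar> \<le> 1" if "k < d" "i < d" for k i
    proof -
      have "A $$ (k, i) * A $$ (k, i) \<le> (\<Sum>k<d. A $$ (k, i) * A $$ (k, i))"
        using that by (intro member_le_sum) auto
      then have "(A $$ (k, i))\<^sup>2 \<le> 1" using s that by (simp add: power2_eq_square)
      then show ?thesis by (simp add: abs_square_le_1)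
    qed
    then have "fst z \<in> P"
      by (auto simp: z motion_coords_def P_def Pi_iff abs_le_iff minus_le_iff)
    moreover have "fst z \<in> E"
      using s by (simp add: z motion_coords_def E_def)
    moreover have "snd z \<in> Q"
      using v by (auto simp: z motion_coords_def Q_def Pi_iff abs_le_iff minus_le_iff)
    ultimately show "z \<in> (P \<inter> E) \<times> Q"
      by (simp add: mem_Times_iff)
  next
    fix z assume z: "z \<in> (P \<inter> E) \<times> Q"
    then obtain a w where zw: "z = (a, w)" by (cases z)
    define A where "A = mat d d a"
    define v where "v = vec d w"
    have "A \<in> orthogonal_matrices d"
      using z zw by (subst orthogonal_matrices_iff_sum) (auto simp: A_def E_def)
    moreover have "\<bar>w i\<bar> \<le> M" if "i < d" for i
    proof -
      have "w i \<in> {-M..M}" using z zw that by (auto simp: Q_def Pi_iff split: if_splits)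
      then show ?thesis by auto
    qed
    ultimately have K: "(A, v) \<in> ?K"
      by (auto simp: Iso_def v_def)
    \<comment> \<open>Coordinates outside the range are frozen at 0, so \<open>z\<close> is
      recovered from the finite matrix and vector.\<close>
    have "a (i, j) = 0" if "\<not> (i < d \<and> j < d)" for i j
    proof -
      have "a (i, j) \<in> (case (i, j) of (i, j) \<Rightarrow> if i < d \<and> j < d then {-1..1} else {0})"
        using z zw unfolding P_def by blast
      with that show ?thesis by auto
    qed
    moreover have "w i = 0" if "\<not> i < d" for i
    proof -
      have "w i \<in> (if i < d then {-M..M} else {0})" using z zw unfolding Q_def by blast
      with that show ?thesis by auto
    qed
    ultimately have "z = motion_coords d (A, v)"
      by (auto simp: zw motion_coords_def A_def v_def fun_eq_iff)
    with K show "z \<in> motion_coords d ` ?K" by blast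
  qed
  with c show "compact (motion_coords d ` ?K)" by simp
qed

text \<open>Comparing translation parts alone yields discreteness. Translations in \<open>H\<close>
  move every vector into a fixed box, so a compact set of motions meets every coset.\<close>

lemma crystallographicI:
  assumes H: "subgroup H (Iso d)"
    and cocompact: "\<And>v. v \<in> carrier_vec d \<Longrightarrow>
      \<exists>w\<in>carrier_vec d. (1\<^sub>m d, w) \<in> H \<and> (\<forall>i<d. \<bar>(v + w) $ i\<bar> \<le> M)"
    and "0 < \<epsilon>"
    and separated: "\<And>A v B w. (A, v) \<in> H \<Longrightarrow> (B, w) \<in> H \<Longrightarrow>
      (\<forall>i<d. \<bar>v $ i - w $ i\<bar> < \<epsilon>) \<Longrightarrow> (A, v) = (B, w)"
  shows "crystallographic d H"
  unfolding crystallographic_def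
proof (intro conjI)
  interpret group "Iso d" by (rule group_Iso)
  interpret H: subgroup H "Iso d" by fact
  show "subgroup H (Iso d)" by fact
  show "subtopology (Iso_topology d) H = discrete_topology H"
    unfolding subtopology_eq_discrete_topology_eq
  proof (intro conjI subset_antisym subsetI)
    fix g assume "g \<in> H" then show "g \<in> topspace (Iso_topology d)"
      using H.subset by auto
  next
    fix g assume "g \<in> H \<inter> Iso_topology d derived_set_of H"
    then have g: "g \<in> H" "g \<in> Iso_topology d derived_set_of H" by auto
    obtain A v where gv: "g = (A, v)" by (cases g)
    \<comment> \<open>In coordinates, \<open>U\<close> consists of the motions whose translation
      part is \<open>\<epsilon>\<close>-close to that of \<open>g\<close>; by
      \<open>separated\<close> no other element of \<open>H\<close> lies there.\<close>
    define U :: "((nat \<times> nat \<Rightarrow> real) \<times> (nat \<Rightarrow> real)) set" where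
      "U = (\<Inter>i\<in>{..<d}. {p. \<bar>v $ i - snd p i\<bar> < \<epsilon>})"
    have "open U"
      unfolding U_def
      by (intro open_INT ballI open_Collect_less continuous_intros
          continuous_on_product_then_coordinatewise) auto
    then have "openin (Iso_topology d) (motion_coords d -` U \<inter> carrier (Iso d))"
      unfolding Iso_topology_def openin_pullback_topology by auto
    moreover have "g \<in> motion_coords d -` U \<inter> carrier (Iso d)"
      using g(1) H.subset \<open>0 < \<epsilon>\<close> by (auto simp: gv U_def motion_coords_def)
    moreover have "\<forall>T. g \<in> T \<and> openin (Iso_topology d) T \<longrightarrow> (\<exists>h\<noteq>g. h \<in> H \<and> h \<in> T)"
      using g(2) by (simp add: in_derived_set_of)
    ultimately obtain h where h: "h \<noteq> g" "h \<in> H"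
        "h \<in> motion_coords d -` U \<inter> carrier (Iso d)"
      by meson
    obtain B w where hw: "h = (B, w)" by (cases h)
    have "\<forall>i<d. \<bar>v $ i - w $ i\<bar> < \<epsilon>"
      using h(3) by (auto simp: hw U_def motion_coords_def)
    then have "g = h" using separated g(1) h(2) by (simp add: gv hw)
    with h show "g \<in> {}" by simp
  qed auto
  let ?K = "{(A, v) \<in> carrier (Iso d). \<forall>i<d. \<bar>v $ i\<bar> \<le> M}"
  let ?q = "\<lambda>g. H #>\<^bsub>Iso d\<^esub> g"
  have q: "quotient_map (Iso_topology d) (coset_topology d H) ?q"
    by (rule quotient_map_coset_topology)
  have c: "compactin (coset_topology d H) (?q ` ?K)"
    by (rule image_compactin[OF compactin_motions_bounded quotient_imp_continuous_map[OF q]])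
  have "topspace (coset_topology d H) \<subseteq> ?q ` ?K"
  proof
    fix C assume "C \<in> topspace (coset_topology d H)"
    then obtain g where g: "g \<in> carrier (Iso d)" "C = ?q g"
      using quotient_imp_surjective_map[OF q] by (metis imageE topspace_Iso_topology)
    obtain A v where gv: "g = (A, v)" by (cases g)
    have A: "A \<in> carrier_mat d d" "v \<in> carrier_vec d"
      using g gv by (auto simp: Iso_def orthogonal_matrices_def)
    then obtain w where w: "w \<in> carrier_vec d" "(1\<^sub>m d, w) \<in> H" "\<forall>i<d. \<bar>(v + w) $ i\<bar> \<le> M"
      using cocompact by blast
    \<comment> \<open>Multiplying on the left by this element of \<open>H\<close> keeps the right
      coset of \<open>g\<close> and changes only the translation part.\<close>
    let ?t = "(1\<^sub>m d, w)"
    have t: "?t \<otimes>\<^bsub>Iso d\<^esub> g = (A, v + w)"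
      using A w by (simp add: gv Iso_def)
    have tc: "?t \<in> carrier (Iso d)" using w H.subset by blast
    have "?q (?t \<otimes>\<^bsub>Iso d\<^esub> g) = (?q ?t) #>\<^bsub>Iso d\<^esub> g"
      using coset_mult_assoc[OF H.subset tc g(1)] by simp
    then have "?q (A, v + w) = C"
      using t w(2) coset_join2[OF tc H] g(2) by simp
    moreover have "(A, v + w) \<in> ?K"
      using w(3) m_closed[OF tc g(1)] unfolding t by auto
    ultimately show "C \<in> ?q ` ?K" by blast
  qed
  then have "?q ` ?K = topspace (coset_topology d H)"
    using compactin_subset_topspace[OF c] by (rule subset_antisym[rotated])
  with c show "compact_space (coset_topology d H)"
    unfolding compact_space_def by (rule back_subst[of "compactin _"])
qed


section \<open>The space of functions with zero fibre sums\<close>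

lemma of_int_divide_in_Ints_iff:
  fixes a r :: int
  assumes "r \<noteq> 0"
  shows "(of_int a / of_int r :: real) \<in> \<int> \<longleftrightarrow> r dvd a"
proof
  assume "(of_int a / of_int r :: real) \<in> \<int>"
  then obtain c where "of_int a / of_int r = (of_int c :: real)" by (elim Ints_cases)
  then have "(of_int a :: real) = of_int (r * c)" using assms by (simp add: field_simps)
  then have "a = r * c" by (simp only: of_int_eq_iff)
  then show "r dvd a" by simp
next
  assume "r dvd a"
  then obtain c where "a = r * c" by (elim dvdE)
  then show "(of_int a / of_int r :: real) \<in> \<int>" using assms by simp
qed

lemma bij_betw_add_mod:
  fixes r b :: int
  assumes "0 < r"
  shows "bij_betw (\<lambda>k. (k + b) mod r) {0..<r} {0..<r}"
  by (rule bij_betwI[where g = "\<lambda>k. (k - b) mod r"])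
    (use assms in \<open>auto simp: mod_simps mod_pos_pos_trivial\<close>)

text \<open>The constant \<open>c = 1 / (r + sqrt r)\<close> solves \<open>(r - 1) c\<^sup>2 - 2 c + 1 / r = 0\<close>, which is what
  orthonormality of the vectors with \<open>s < r - 1\<close> requires.\<close>

definition zero_sum_basis :: "int \<Rightarrow> int \<Rightarrow> int \<Rightarrow> real" where
  "zero_sum_basis r s k =
    (if k = r - 1 then - 1 / sqrt r else (if s = k then 1 else 0) - 1 / (r + sqrt r))"

context
  fixes r :: int
  assumes r_pos: "0 < r"
begin

lemma split_last: "{0..<r} = insert (r - 1) {0..<r - 1}"
  using r_pos by auto

lemma zero_sum_basis_constants:
  fixes c :: real defines "c \<equiv> 1 / (r + sqrt r)"
  shows "(r - 1) * c\<^sup>2 - 2 * c + 1 / r = 0" "1 - (r - 1) * c = 1 / sqrt r"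
proof -
  define q where "q = sqrt r"
  have q: "0 < q" "of_int r = q\<^sup>2" using r_pos by (auto simp: q_def)
  \<comment> \<open>With \<open>q\<close> the square root of \<open>r\<close>, the sum
    \<open>r + q\<close> factors, and both identities become rational in \<open>q\<close>.\<close>
  have c: "c = 1 / (q * (q + 1))"
  proof -
    have "r + q = q * (q + 1)" unfolding q(2) by (simp add: power2_eq_square algebra_simps)
    then show ?thesis by (simp only: c_def q_def)
  qed
  show "(r - 1) * c\<^sup>2 - 2 * c + 1 / r = 0"
    unfolding c using q by (simp add: divide_simps) (simp add: power2_eq_square algebra_simps)
  show "1 - (r - 1) * c = 1 / sqrt r"
    unfolding c q_def[symmetric]
    using q by (simp add: divide_simps) (simp add: power2_eq_square algebra_simps)
qed

text \<open>Used twice: summing over the point gives orthonormality, summing over the basis index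
  gives completeness.\<close>

lemma sum_delta_minus:
  fixes c :: real
  assumes "s \<in> {0..<r - 1}" "t \<in> {0..<r - 1}"
  shows "(\<Sum>k\<in>{0..<r - 1}. ((if s = k then 1 else 0) - c) * ((if t = k then 1 else 0) - c))
    = (if s = t then 1 else 0) + ((r - 1) * c\<^sup>2 - 2 * c)"
proof -
  have "(\<Sum>k\<in>{0..<r - 1}. ((if s = k then 1 else 0) - c) * ((if t = k then 1 else 0) - c))
     = (\<Sum>k\<in>{0..<r - 1}. (if s = k then (if t = k then 1 else 0) else 0)
        - c * (if s = k then 1 else 0) - c * (if t = k then 1 else 0) + c\<^sup>2)"
    by (intro sum.cong) (auto simp: algebra_simps power2_eq_square)
  also have "\<dots> = (if s = t then 1 else 0) - c - c + (r - 1) * c\<^sup>2"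
    using assms r_pos
    by (simp add: sum.distrib sum_subtractf sum_distrib_left[symmetric] eq_commute of_nat_nat)
  finally show ?thesis by simp
qed

lemma zero_sum_basis_orthonormal:
  assumes s: "s \<in> {0..<r - 1}" and t: "t \<in> {0..<r - 1}"
  shows "(\<Sum>k\<in>{0..<r}. zero_sum_basis r s k * zero_sum_basis r t k) = (if s = t then 1 else 0)"
proof -
  have "(\<Sum>k\<in>{0..<r}. zero_sum_basis r s k * zero_sum_basis r t k) = 1 / r +
     (\<Sum>k\<in>{0..<r - 1}. ((if s = k then 1 else 0) - 1 / (r + sqrt r)) *
        ((if t = k then 1 else 0) - 1 / (r + sqrt r)))"
    unfolding split_last using r_pos
    by (auto simp: zero_sum_basis_def intro!: sum.cong)
  also have "\<dots> = (if s = t then 1 else 0)"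
    using zero_sum_basis_constants(1) by (subst sum_delta_minus[OF s t]) (simp add: algebra_simps)
  finally show ?thesis .
qed

text \<open>The right side is the kernel of the orthogonal projection onto the functions of sum
  zero, so the \<open>r - 1\<close> basis vectors span all of them.\<close>

lemma zero_sum_basis_complete:
  assumes k: "k \<in> {0..<r}" and l: "l \<in> {0..<r}"
  shows "(\<Sum>s\<in>{0..<r - 1}. zero_sum_basis r s k * zero_sum_basis r s l)
    = (if k = l then 1 else 0) - 1 / r"
proof -
  let ?c = "1 / (r + sqrt r)"
  have mixed: "(\<Sum>s\<in>{0..<r - 1}. zero_sum_basis r s k * zero_sum_basis r s l) = - 1 / r"
    if kl: "k \<in> {0..<r - 1}" "l = r - 1" for k l
  proof -
    have "(\<Sum>s\<in>{0..<r - 1}. zero_sum_basis r s k * zero_sum_basis r s l)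
       = (\<Sum>s\<in>{0..<r - 1}. (if s = k then 1 else 0) - ?c) * (- 1 / sqrt r)"
      unfolding sum_distrib_right using kl by (intro sum.cong) (auto simp: zero_sum_basis_def)
    also have "(\<Sum>s\<in>{0..<r - 1}. (if s = k then 1 else 0) - ?c) = 1 - (r - 1) * ?c"
      using kl r_pos by (simp add: sum_subtractf)
    also have "\<dots> = 1 / sqrt r" by (rule zero_sum_basis_constants(2))
    finally show ?thesis using r_pos by simp
  qed
  consider "k = r - 1" "l = r - 1" | "k \<in> {0..<r - 1}" "l = r - 1"
    | "k = r - 1" "l \<in> {0..<r - 1}" | "k \<in> {0..<r - 1}" "l \<in> {0..<r - 1}"
    using k l by fastforce
  then show ?thesis
  proof cases
    case 1
    then show ?thesis using r_pos by (simp add: zero_sum_basis_def field_simps)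
  next
    case 2
    then show ?thesis using mixed by simp
  next
    case 3
    then show ?thesis using mixed[of l k] by (simp add: mult.commute)
  next
    case 4
    have "(\<Sum>s\<in>{0..<r - 1}. zero_sum_basis r s k * zero_sum_basis r s l)
      = (\<Sum>s\<in>{0..<r - 1}. ((if k = s then 1 else 0) - ?c) * ((if l = s then 1 else 0) - ?c))"
      using 4 by (intro sum.cong) (auto simp: zero_sum_basis_def)
    also have "\<dots> = (if k = l then 1 else 0) - 1 / r"
      using zero_sum_basis_constants(1) by (subst sum_delta_minus[OF 4]) (simp add: algebra_simps)
    finally show ?thesis .
  qed
qed

lemma abs_zero_sum_basis_le: "\<bar>zero_sum_basis r s k\<bar> \<le> 2"
proof -
  define u w where "u = 1 / sqrt r" and "w = 1 / (r + sqrt r)"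
  have "1 \<le> sqrt r" using r_pos by simp
  moreover from this have "1 \<le> r + sqrt r" using r_pos by linarith
  ultimately have "0 \<le> u" "u \<le> 1" "0 \<le> w" "w \<le> 1"
    unfolding u_def w_def by (auto simp: divide_le_eq_1)
  moreover have "zero_sum_basis r s k = (if k = r - 1 then - u else (if s = k then 1 else 0) - w)"
    by (simp add: zero_sum_basis_def u_def w_def)
  ultimately show ?thesis by auto
qed

end

text \<open>\<open>r dvd m\<close> lets addition modulo \<open>m\<close> act on the last fibre,
  which has size \<open>r\<close>. The condition on primes rules out torsion and forces
  \<open>m = 1\<close> when \<open>r = 1\<close>.\<close>

locale twisted_lattice =
  fixes m r :: int
  assumes r_pos: "0 < r" and m_pos: "0 < m" and r_dvd_m: "r dvd m"
    and prime_dvd_r: "\<And>p. prime p \<Longrightarrow> p dvd m \<Longrightarrow> p dvd r"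
begin

definition X :: "(int \<times> int) set" where
  "X = {0..m} \<times> {0..<r}"

text \<open>Each of the \<open>m + 1\<close> fibres contributes the \<open>r - 1\<close> vectors of
  its zero sum basis.\<close>

definition I :: "(int \<times> int) set" where
  "I = {0..m} \<times> {0..<r - 1}"

definition d :: nat where
  "d = card I"

definition enum :: "nat \<Rightarrow> int \<times> int" where
  "enum = (SOME f. bij_betw f {..<d} I)"

definition e :: "nat \<Rightarrow> int \<times> int \<Rightarrow> real" where
  "e \<alpha> = (\<lambda>(j, k). if fst (enum \<alpha>) = j then zero_sum_basis r (snd (enum \<alpha>)) k else 0)"

lemma bij_enum: "bij_betw enum {..<d} I"
proof -
  have "finite I" by (simp add: I_def)
  then obtain f where "bij_betw f {..<d} I"
    using ex_bij_betw_nat_finite[of I] by (auto simp: d_def lessThan_atLeast0)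
  then show ?thesis unfolding enum_def by (rule someI[where P = "\<lambda>f. bij_betw f {..<d} I"])
qed

lemma sum_X: "(\<Sum>z\<in>X. f z) = (\<Sum>j\<in>{0..m}. \<Sum>k\<in>{0..<r}. f (j, k))"
  by (simp add: X_def sum.cartesian_product)

section \<open>The span of the frame\<close>

sublocale orthonormal_frame X d e
proof
  show "finite X" by (simp add: X_def)
  fix \<alpha> \<beta> assume l: "\<alpha> < d" "\<beta> < d"
  obtain i s j t where st: "enum \<alpha> = (i, s)" "enum \<beta> = (j, t)" by fastforce
  have I: "(i, s) \<in> I" "(j, t) \<in> I"
    using l st bij_enum by (metis bij_betwE lessThan_iff)+
  have eq: "\<alpha> = \<beta> \<longleftrightarrow> i = j \<and> s = t"
    using l st bij_enum by (metis bij_betw_inv_into_left lessThan_iff prod.inject)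
  have "(\<Sum>x\<in>X. e \<alpha> x * e \<beta> x) = (\<Sum>j'\<in>{0..m}. if j' = i then
      (if i = j then \<Sum>k\<in>{0..<r}. zero_sum_basis r s k * zero_sum_basis r t k else 0) else 0)"
    unfolding sum_X by (intro sum.cong) (auto simp: e_def st)
  also have "\<dots> = (if \<alpha> = \<beta> then 1 else 0)"
    using I zero_sum_basis_orthonormal[OF r_pos, of s t] by (auto simp: I_def eq)
  finally show "(\<Sum>x\<in>X. e \<alpha> x * e \<beta> x) = (if \<alpha> = \<beta> then 1 else 0)" .
qed

text \<open>Vectors on different fibres have disjoint supports, so the projection kernel is block
  diagonal with the blocks of \<open>zero_sum_basis_complete\<close>.\<close>

lemma frame_kernel:
  assumes "(j, k) \<in> X" "(j', k') \<in> X"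
  shows "(\<Sum>\<alpha><d. e \<alpha> (j, k) * e \<alpha> (j', k')) =
    (if j = j' then (if k = k' then 1 else 0) - 1 / r else 0)"
proof -
  have "(\<Sum>\<alpha><d. e \<alpha> (j, k) * e \<alpha> (j', k')) =
     (\<Sum>\<alpha><d. (\<lambda>(i, s). (if i = j then zero_sum_basis r s k else 0) *
        (if i = j' then zero_sum_basis r s k' else 0)) (enum \<alpha>))"
    by (intro sum.cong) (auto simp: e_def split: prod.splits)
  also have "\<dots> = (\<Sum>(i, s)\<in>I. (if i = j then zero_sum_basis r s k else 0) *
        (if i = j' then zero_sum_basis r s k' else 0))"
    by (rule sum.reindex_bij_betw[OF bij_enum])
  also have "\<dots> = (\<Sum>i\<in>{0..m}. if i = j then (if j = j' then
      \<Sum>s\<in>{0..<r - 1}. zero_sum_basis r s k * zero_sum_basis r s k' else 0) else 0)"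
    unfolding I_def sum.cartesian_product[symmetric] by (intro sum.cong) auto
  also have "\<dots> = (if j = j' then (if k = k' then 1 else 0) - 1 / r else 0)"
    using assms zero_sum_basis_complete[OF r_pos, of k k'] by (auto simp: X_def)
  finally show ?thesis .
qed

text \<open>Summing against \<open>frame_kernel\<close> subtracts the fibre mean, so the projection
  fixes exactly the functions with mean zero on each fibre.\<close>

lemma synth_coords:
  assumes "(j, k) \<in> X"
  shows "synth (coords y) (j, k) = y (j, k) - (\<Sum>l\<in>{0..<r}. y (j, l)) / r"
proof -
  have "synth (coords y) (j, k) = (\<Sum>\<alpha><d. (\<Sum>x\<in>X. e \<alpha> x * y x) * e \<alpha> (j, k))"
    by (simp add: synth_def coords_def)
  also have "\<dots> = (\<Sum>x\<in>X. y x * (\<Sum>\<alpha><d. e \<alpha> (j, k) * e \<alpha> x))"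
    by (simp add: sum_distrib_left sum_distrib_right mult_ac sum.swap[of _ X])
  also have "\<dots> = (\<Sum>j'\<in>{0..m}. if j' = j then
      \<Sum>l\<in>{0..<r}. (if l = k then y (j, l) else 0) - y (j, l) / r else 0)"
    unfolding sum_X using assms
    by (intro sum.cong) (auto simp: frame_kernel X_def algebra_simps intro!: sum.cong)
  also have "\<dots> = y (j, k) - (\<Sum>l\<in>{0..<r}. y (j, l)) / r"
    using assms by (simp add: X_def sum_subtractf sum_divide_distrib)
  finally show ?thesis .
qed

lemma spanned_iff: "spanned y \<longleftrightarrow> (\<forall>j\<in>{0..m}. (\<Sum>k\<in>{0..<r}. y (j, k)) = 0)"
proof -
  have ball_X: "(\<forall>z\<in>X. P z) \<longleftrightarrow> (\<forall>j\<in>{0..m}. \<forall>k\<in>{0..<r}. P (j, k))" for P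
    by (auto simp: X_def)
  have "synth (coords y) (j, k) = y (j, k) \<longleftrightarrow> (\<Sum>l\<in>{0..<r}. y (j, l)) = 0"
    if "j \<in> {0..m}" "k \<in> {0..<r}" for j k
    using synth_coords[of j k y] that r_pos by (simp add: X_def)
  then have "spanned y \<longleftrightarrow> (\<forall>j\<in>{0..m}. \<forall>k\<in>{0..<r}. (\<Sum>l\<in>{0..<r}. y (j, l)) = 0)"
    by (simp add: spanned_def ball_X del: atLeastAtMost_iff atLeastLessThan_iff)
  then show ?thesis
    using r_pos by force
qed

end


section \<open>The group of twisted shifts\<close>

context twisted_lattice
begin

section \<open>Shifts, carries and admissible translation parts\<close>

definition shift :: "int \<Rightarrow> int \<Rightarrow> int \<times> int \<Rightarrow> int \<times> int" where
  "shift a b = (\<lambda>(j, k). if j < m then ((j + a) mod m, (k + b) mod r) else (j, (k + a) mod r))"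

text \<open>Below \<open>m\<close> this is the signed number of times that adding \<open>a\<close>
  passes a multiple of \<open>m\<close>. The shift sees \<open>a\<close> there only modulo
  \<open>m\<close>, and the carry keeps the rest.\<close>

definition carry :: "int \<Rightarrow> int \<Rightarrow> int \<times> int \<Rightarrow> int" where
  "carry a b = (\<lambda>(j, k). if j < m then (j + a) div m else b)"

definition admissible :: "int \<Rightarrow> int \<Rightarrow> (int \<times> int \<Rightarrow> real) \<Rightarrow> bool" where
  "admissible a b x \<longleftrightarrow> spanned x \<and> (\<forall>z\<in>X. x z - of_int (carry a b z) / of_int r \<in> \<int>)"

text \<open>In coordinates, the map \<open>y \<mapsto> y \<circ> shift a b + x\<close>. The integers
  \<open>a\<close> and \<open>b\<close> serve instead of residues, so one motion has many parameter
  pairs.\<close>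

definition motion :: "int \<Rightarrow> int \<Rightarrow> (int \<times> int \<Rightarrow> real) \<Rightarrow> euclidean_motion" where
  "motion a b x = (compose_mat (shift a b), coords x)"

definition H :: "euclidean_motion set" where
  "H = {motion a b x | a b x. admissible a b x}"

lemma shift_in_X: "z \<in> X \<Longrightarrow> shift a b z \<in> X"
  using r_pos m_pos by (auto simp: X_def shift_def less_imp_le)

lemma shift_shift: "shift a b (shift a' b' z) = shift (a + a') (b + b') z"
  using m_pos by (auto simp: shift_def mod_simps add_ac split: prod.split)

lemma shift_ident:
  assumes "m dvd a" "r dvd b" "z \<in> X"
  shows "shift a b z = z"
proof -
  have "r dvd a" using assms r_dvd_m by (rule_tac dvd_trans)
  with assms show ?thesis
    by (auto simp: shift_def X_def mod_add_right_eq[symmetric] split: prod.split)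
qed

lemma bij_shift: "bij_betw (shift a b) X X"
  by (rule bij_betwI[where g = "shift (- a) (- b)"])
    (auto simp: shift_in_X shift_shift shift_ident)

text \<open>The cocycle rule: carries of two successive additions add up along the orbit, as
  \<open>j + a\<close> is its quotient times \<open>m\<close> plus its remainder.\<close>

lemma carry_add: "carry (a + a') (b + b') z = carry a b z + carry a' b' (shift a b z)"
proof -
  have "(j + (a + a')) div m = (j + a) div m + ((j + a) mod m + a') div m" for j
  proof -
    have "j + (a + a') = ((j + a) mod m + a') + (j + a) div m * m"
      by (simp add: algebra_simps)
    then show ?thesis using m_pos by (metis add.commute div_mult_self1 less_irrefl)
  qed
  then show ?thesis using m_pos by (auto simp: carry_def shift_def split: prod.split)
qed

text \<open>A shift maps each fibre bijectively onto a fibre.\<close>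

lemma spanned_shift:
  assumes "spanned y"
  shows "spanned (\<lambda>z. y (shift a b z))"
  unfolding spanned_iff
proof
  fix j assume j: "j \<in> {0..m}"
  have reindex: "(\<Sum>k\<in>{0..<r}. y (i, (k + c) mod r)) = 0" if "i \<in> {0..m}" for i c
    using sum.reindex_bij_betw[OF bij_betw_add_mod[OF r_pos], of "\<lambda>k. y (i, k)" c] assms that
    by (simp add: spanned_iff)
  show "(\<Sum>k\<in>{0..<r}. y (shift a b (j, k))) = 0"
    using j m_pos by (cases "j < m") (auto simp: shift_def reindex less_imp_le)
qed

lemma spanned_add: "spanned x \<Longrightarrow> spanned y \<Longrightarrow> spanned (\<lambda>z. x z + y z)"
  by (simp add: spanned_iff sum.distrib)

lemma spanned_uminus: "spanned x \<Longrightarrow> spanned (\<lambda>z. - x z)"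
  by (simp add: spanned_iff sum_negf)

lemma spanned_zero: "spanned (\<lambda>z. 0)"
  by (simp add: spanned_iff)

lemma carry_zero: "z \<in> X \<Longrightarrow> carry 0 0 z = 0"
  by (cases z) (simp add: carry_def X_def)

lemma admissible_zero: "admissible 0 0 (\<lambda>z. 0)"
  unfolding admissible_def using spanned_zero m_pos by (simp add: carry_zero)

lemma admissible_add:
  assumes "admissible a b x" "admissible a' b' x'"
  shows "admissible (a + a') (b + b') (\<lambda>z. x z + x' (shift a b z))"
  unfolding admissible_def
proof (intro conjI ballI)
  show "spanned (\<lambda>z. x z + x' (shift a b z))"
    using assms by (auto simp: admissible_def intro!: spanned_add spanned_shift)
  fix z assume z: "z \<in> X"
  have "(x z - carry a b z / r) + (x' (shift a b z) - carry a' b' (shift a b z) / r) \<in> \<int>"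
    using assms z shift_in_X[OF z] by (intro Ints_add) (auto simp: admissible_def)
  then show "x z + x' (shift a b z) - carry (a + a') (b + b') z / r \<in> \<int>"
    by (simp add: carry_add add_divide_distrib algebra_simps)
qed

lemma admissible_inverse:
  assumes "admissible a b x"
  shows "admissible (- a) (- b) (\<lambda>z. - x (shift (- a) (- b) z))"
  unfolding admissible_def
proof (intro conjI ballI)
  show "spanned (\<lambda>z. - x (shift (- a) (- b) z))"
    using assms by (auto simp: admissible_def intro!: spanned_uminus spanned_shift)
  fix z assume z: "z \<in> X"
  have "carry 0 0 z = 0" by (rule carry_zero[OF z])
  then have "carry (- a) (- b) z = - carry a b (shift (- a) (- b) z)"
    using carry_add[of "- a" a "- b" b z] by simp
  moreover have "- (x (shift (- a) (- b) z) - carry a b (shift (- a) (- b) z) / r) \<in> \<int>"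
    using assms shift_in_X[OF z] by (intro Ints_minus) (auto simp: admissible_def)
  ultimately show "- x (shift (- a) (- b) z) - carry (- a) (- b) z / r \<in> \<int>"
    by (simp add: algebra_simps)
qed

lemma admissible_exists: "\<exists>x. admissible a b x"
proof -
  \<comment> \<open>The constant \<open>carry / r\<close> on a fibre has the integer
    \<open>carry\<close> as its sum, so subtracting that integer at the last point gives sum zero
    without changing residues modulo 1.\<close>
  define x :: "int \<times> int \<Rightarrow> real" where
    "x z = carry a b z * (1 / r - (if snd z = r - 1 then 1 else 0))" for z
  have "spanned x"
    unfolding spanned_iff
  proof
    fix j assume "j \<in> {0..m}"
    have "(\<Sum>k\<in>{0..<r}. x (j, k)) =
        carry a b (j, 0) * (\<Sum>k\<in>{0..<r}. 1 / r - (if k = r - 1 then 1 else 0))"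
      unfolding sum_distrib_left by (intro sum.cong) (auto simp: x_def carry_def)
    also have "(\<Sum>k\<in>{0..<r}. 1 / r - (if k = r - 1 then 1 else 0)) = (0 :: real)"
      using r_pos by (simp add: sum_subtractf)
    finally show "(\<Sum>k\<in>{0..<r}. x (j, k)) = 0" by simp
  qed
  moreover have "x z - carry a b z / r \<in> \<int>" for z
    by (simp add: x_def algebra_simps)
  ultimately show ?thesis by (auto simp: admissible_def)
qed

section \<open>The group law of the motions\<close>

lemma compose_mat_shift_orthogonal: "compose_mat (shift a b) \<in> orthogonal_matrices d"
proof -
  have "transpose_mat (compose_mat (shift a b)) = compose_mat (shift (- a) (- b))"
    by (rule compose_mat_transpose[OF bij_shift]) (simp add: shift_shift shift_ident)
  moreover have "compose_mat (shift (- a) (- b)) * compose_mat (shift a b) = 1\<^sub>m d"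
    by (subst compose_mat_mult) (auto simp: shift_in_X spanned_shift shift_shift shift_ident
        intro!: compose_mat_ident)
  ultimately show ?thesis by (simp add: orthogonal_matrices_def)
qed

lemma motion_carrier: "motion a b x \<in> carrier (Iso d)"
  by (simp add: motion_def Iso_def compose_mat_shift_orthogonal)

text \<open>Shifts commute, so the reversed order of composition in \<open>compose_mat\<close> does
  not show.\<close>

lemma motion_mult:
  assumes "spanned x'"
  shows "motion a b x \<otimes>\<^bsub>Iso d\<^esub> motion a' b' x' = motion (a + a') (b + b') (\<lambda>z. x z + x' (shift a b z))"
proof -
  have "compose_mat (shift a b) * compose_mat (shift a' b') = compose_mat (shift (a + a') (b + b'))"
    by (subst compose_mat_mult) (auto simp: shift_in_X spanned_shift shift_shift add.commute)
  moreover have "compose_mat (shift a b) *\<^sub>v coords x' + coords x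
      = coords (\<lambda>z. x z + x' (shift a b z))"
    using assms shift_in_X
    by (subst compose_mat_mult_coords) (auto simp: coords_add comm_add_vec[of _ d])
  ultimately show ?thesis by (simp add: motion_def Iso_def)
qed

lemma coords_zero: "coords (\<lambda>z. 0) = 0\<^sub>v d"
  by (rule eq_vecI) (auto simp: coords_def)

lemma motion_one: 
  assumes "m dvd a" "r dvd b" "\<And>z. z \<in> X \<Longrightarrow> x z = 0"
  shows "motion a b x = \<one>\<^bsub>Iso d\<^esub>"
proof -
  have "coords x = 0\<^sub>v d" using assms(3) by (subst coords_zero[symmetric]) (rule coords_cong)
  moreover have "compose_mat (shift a b) = 1\<^sub>m d"
    using assms by (intro compose_mat_ident shift_ident)
  ultimately show ?thesis by (simp add: motion_def Iso_def)
qed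

lemma motion_inverse:
  assumes "spanned x"
  shows "inv\<^bsub>Iso d\<^esub> motion a b x = motion (- a) (- b) (\<lambda>z. - x (shift (- a) (- b) z))"
proof -
  interpret group "Iso d" by (rule group_Iso)
  have "motion (- a) (- b) (\<lambda>z. - x (shift (- a) (- b) z)) \<otimes>\<^bsub>Iso d\<^esub> motion a b x = \<one>\<^bsub>Iso d\<^esub>"
    using assms by (simp add: motion_mult motion_one)
  then show ?thesis by (intro inv_equality motion_carrier)
qed

lemma subgroup_H: "subgroup H (Iso d)"
proof -
  interpret group "Iso d" by (rule group_Iso)
  show ?thesis
  proof
    show "H \<subseteq> carrier (Iso d)" by (auto simp: H_def motion_carrier)
    have "motion 0 0 (\<lambda>z. 0) = \<one>\<^bsub>Iso d\<^esub>" by (rule motion_one) auto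
    then show "\<one>\<^bsub>Iso d\<^esub> \<in> H"
      unfolding H_def using admissible_zero by (metis (mono_tags, lifting) mem_Collect_eq)
    fix g assume "g \<in> H"
    then obtain a b x where g: "g = motion a b x" "admissible a b x" by (auto simp: H_def)
    then show "inv\<^bsub>Iso d\<^esub> g \<in> H"
      using admissible_inverse[OF g(2)] by (auto simp: H_def admissible_def motion_inverse)
    fix h assume "h \<in> H"
    then obtain a' b' y where h: "h = motion a' b' y" "admissible a' b' y" by (auto simp: H_def)
    then have "g \<otimes>\<^bsub>Iso d\<^esub> h = motion (a + a') (b + b') (\<lambda>z. x z + y (shift a b z))"
      by (simp add: g motion_mult admissible_def)
    then show "g \<otimes>\<^bsub>Iso d\<^esub> h \<in> H"
      using admissible_add[OF g(2) h(2)] unfolding H_def by blast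
  qed
qed

section \<open>Elements without translation part\<close>

lemma r_dvd_carry:
  assumes "admissible a b x" "z \<in> X" "x z = 0"
  shows "r dvd carry a b z"
proof -
  have "- (carry a b z / r) \<in> \<int>" using assms unfolding admissible_def by force
  then have "carry a b z / r \<in> \<int>" by (metis Ints_minus minus_minus)
  then show ?thesis using r_pos by (simp add: of_int_divide_in_Ints_iff)
qed

text \<open>If \<open>m\<close> does not divide \<open>a\<close>, the carries at positions
  \<open>0\<close> and \<open>m - 1\<close> differ by 1, so \<open>r\<close> cannot divide both
  unless \<open>r = 1\<close>. Hence \<open>a\<close> is a multiple of \<open>m\<close>, and its
  carry \<open>a div m\<close> is one of \<open>r\<close>.\<close>

lemma admissible_zero_dvd:
  assumes adm: "admissible a b x" and zero: "\<And>z. z \<in> X \<Longrightarrow> x z = 0"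
  shows "m * r dvd a" "r dvd b"
proof -
  have X: "(0, 0) \<in> X" "(m - 1, 0) \<in> X" "(m, 0) \<in> X" using m_pos r_pos by (auto simp: X_def)
  show "r dvd b" using r_dvd_carry[OF adm X(3) zero] X by (simp add: carry_def)
  have first: "r dvd a div m" and last: "r dvd (m - 1 + a) div m"
    using r_dvd_carry[OF adm X(1) zero] r_dvd_carry[OF adm X(2) zero] X m_pos
    by (auto simp: carry_def)
  show "m * r dvd a"
  \<comment> \<open>For \<open>r = 1\<close> the carries say nothing, but then \<open>m\<close> has
    no prime divisor.\<close>
  proof (cases "r = 1")
    case True
    have "is_unit m"
    proof (rule ccontr)
      assume "\<not> is_unit m"
      then obtain p where "prime p" "p dvd m" using prime_divisor_exists[of m] m_pos by auto
      then show False using prime_dvd_r[of p] True not_prime_unit by auto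
    qed
    then show ?thesis using True m_pos by simp
  next
    case False
    have "m dvd a"
    proof (rule ccontr)
      assume "\<not> m dvd a"
      then have pos: "0 < a mod m"
        using m_pos by (metis dvd_eq_mod_eq_0 less_le pos_mod_sign)
      then have "(a mod m - 1) div m = 0"
        using pos_mod_bound[OF m_pos, of a] by (intro div_pos_pos_trivial) linarith+
      moreover have "(m - 1 + a) div m = ((a mod m - 1) + (a div m + 1) * m) div m"
        by (simp add: algebra_simps)
      ultimately have "(m - 1 + a) div m = a div m + 1"
        using m_pos by (metis add.right_neutral div_mult_self1 less_irrefl)
      then have "r dvd 1" using first last by (metis dvd_add_right_iff)
      then show False using False r_pos by simp
    qed
    then show ?thesis using first m_pos by (auto elim!: dvdE)
  qed
qed

text \<open>The divisibilities make the linear part trivial as well. They also determine the first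
  parameter of the identity modulo \<open>m * r\<close>, which yields the lower bound for the
  exponent.\<close>

lemma admissible_motion_one:
  assumes "admissible a b x" "coords x = 0\<^sub>v d"
  shows "m * r dvd a" "r dvd b" "motion a b x = \<one>\<^bsub>Iso d\<^esub>"
proof -
  have zero: "x z = 0" if "z \<in> X" for z
    using assms that coords_eqD[of x "\<lambda>z. 0"] by (simp add: admissible_def coords_zero spanned_zero)
  show *: "m * r dvd a" "r dvd b" using admissible_zero_dvd[OF assms(1) zero] by auto
  show "motion a b x = \<one>\<^bsub>Iso d\<^esub>"
    by (rule motion_one[OF _ *(2) zero]) (use *(1) in \<open>rule dvd_mult_left\<close>)
qed

end


section \<open>The Bieberbach property\<close>

context twisted_lattice
begin

section \<open>Cocompactness and discreteness\<close>

lemma abs_e_le: "\<bar>e \<alpha> z\<bar> \<le> 2"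
  using abs_zero_sum_basis_le[OF r_pos] by (auto simp: e_def split: prod.split)

lemma abs_coords_le:
  fixes B :: real
  assumes "i < d" "\<And>z. z \<in> X \<Longrightarrow> \<bar>y z\<bar> \<le> B"
  shows "\<bar>coords y $ i\<bar> \<le> card X * (2 * B)"
proof -
  have "\<bar>coords y $ i\<bar> \<le> (\<Sum>z\<in>X. \<bar>e i z * y z\<bar>)"
    using assms(1) by (simp add: coords_def sum_abs)
  also have "\<dots> \<le> (\<Sum>z\<in>X. 2 * B)"
    using assms(2) abs_e_le by (intro sum_mono) (simp add: abs_mult mult_mono)
  finally show ?thesis by simp
qed

lemma lattice_cocompact:
  assumes v: "v \<in> carrier_vec d"
  shows "\<exists>w\<in>carrier_vec d. (1\<^sub>m d, w) \<in> H \<and> (\<forall>i<d. \<bar>(v + w) $ i\<bar> \<le> real (card X) * (2 * of_int r))"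
proof -
  define y where "y = synth v"
  have y: "spanned y" "coords y = v" using v by (simp_all add: y_def spanned_synth coords_synth)
  \<comment> \<open>All values of a fibre but the last are rounded down, leaving rests between 0 and
    1. The last value of \<open>x\<close> restores the zero sum, and what remains there is minus the
    sum of the \<open>r - 1\<close> rests.\<close>
  define x :: "int \<times> int \<Rightarrow> real" where
    "x = (\<lambda>(j, k). of_int (if k = r - 1 then \<Sum>l\<in>{0..<r - 1}. \<lfloor>y (j, l)\<rfloor> else - \<lfloor>y (j, k)\<rfloor>))"
  have sum_last: "(\<Sum>k\<in>{0..<r}. f k) = f (r - 1) + (\<Sum>k\<in>{0..<r - 1}. f k)" for f :: "int \<Rightarrow> real"
    by (simp add: split_last[OF r_pos])
  have "(\<Sum>k\<in>{0..<r}. x (j, k)) = 0" for j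
    by (simp add: sum_last x_def sum_negf)
  then have x: "spanned x" by (simp add: spanned_iff)
  moreover have "x z \<in> \<int>" for z by (cases z) (simp only: x_def prod.case Ints_of_int)
  ultimately have adm: "admissible 0 0 x" by (simp add: admissible_def carry_zero)
  have "compose_mat (shift 0 0) = 1\<^sub>m d" by (intro compose_mat_ident shift_ident) auto
  then have "(1\<^sub>m d, coords x) = motion 0 0 x" by (simp add: motion_def)
  then have mem: "(1\<^sub>m d, coords x) \<in> H" unfolding H_def using adm by blast
  have "\<bar>y z + x z\<bar> \<le> r" if z: "z \<in> X" for z
  proof -
    obtain j k where jk: "z = (j, k)" "j \<in> {0..m}" "k \<in> {0..<r}" using z by (auto simp: X_def)
    have small: "0 \<le> y w - \<lfloor>y w\<rfloor> \<and> y w - \<lfloor>y w\<rfloor> \<le> 1" for w by linarith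
    show ?thesis
    proof (cases "k = r - 1")
      case True
      have "y (j, r - 1) = - (\<Sum>l\<in>{0..<r - 1}. y (j, l))"
        using y(1) jk(2) by (simp add: spanned_iff sum_last add_eq_0_iff)
      then have eq: "y z + x z = - (\<Sum>l\<in>{0..<r - 1}. y (j, l) - \<lfloor>y (j, l)\<rfloor>)"
        by (simp add: jk(1) True x_def sum_subtractf)
      have "0 \<le> (\<Sum>l\<in>{0..<r - 1}. y (j, l) - \<lfloor>y (j, l)\<rfloor>)"
        using small by (intro sum_nonneg) blast
      moreover have "(\<Sum>l\<in>{0..<r - 1}. y (j, l) - \<lfloor>y (j, l)\<rfloor>) \<le> (\<Sum>l\<in>{0..<r - 1}. 1)"
        using small by (intro sum_mono) blast
      ultimately show ?thesis using r_pos unfolding eq by simp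
    next
      case False
      then have "y z + x z = y z - \<lfloor>y z\<rfloor>" by (simp add: jk(1) x_def)
      moreover have "1 \<le> real_of_int r" using r_pos by simp
      ultimately show ?thesis using small[of z] by linarith
    qed
  qed
  then have "\<forall>i<d. \<bar>coords (\<lambda>z. y z + x z) $ i\<bar> \<le> real (card X) * (2 * of_int r)"
    by (intro allI impI abs_coords_le)
  then show ?thesis using mem by (intro bexI[of _ "coords x"]) (auto simp: coords_add y(2))
qed

text \<open>Translation parts take values in the multiples of \<open>1 / r\<close>, so close ones
  agree. The quotient of the two elements then has zero translation part and is trivial.\<close>

lemma lattice_separated:
  assumes g: "(A, v) \<in> H" and h: "(B, w) \<in> H"
    and close: "\<forall>i<d. \<bar>v $ i - w $ i\<bar> < 1 / (2 * r * (d + 1))"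
  shows "(A, v) = (B, w)"
proof -
  interpret group "Iso d" by (rule group_Iso)
  obtain a b x where gx: "(A, v) = motion a b x" "admissible a b x" using g by (auto simp: H_def)
  obtain a' b' y where hy: "(B, w) = motion a' b' y" "admissible a' b' y" using h by (auto simp: H_def)
  have vw: "v = coords x" "w = coords y" using gx hy by (auto simp: motion_def)
  have sp: "spanned x" "spanned y" using gx hy by (auto simp: admissible_def)
  have xy: "x z = y z" if z: "z \<in> X" for z
  proof -
    have "x z - y z = synth v z - synth w z"
      using sp z by (simp add: vw spanned_def)
    also have "\<dots> = (\<Sum>\<alpha><d. (v $ \<alpha> - w $ \<alpha>) * e \<alpha> z)"
      by (simp add: synth_def sum_subtractf algebra_simps)
    finally have "\<bar>x z - y z\<bar> \<le> (\<Sum>\<alpha><d. \<bar>(v $ \<alpha> - w $ \<alpha>) * e \<alpha> z\<bar>)" by (simp add: sum_abs)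
    \<comment> \<open>The factor 2 bounds the frame vectors; \<open>d + 1\<close> makes the total of
      \<open>d\<close> summands less than \<open>1 / r\<close> and keeps the bound meaningful for
      \<open>d = 0\<close>.\<close>
    also have "\<dots> \<le> (\<Sum>\<alpha><d. 1 / (2 * r * (d + 1)) * 2)"
    proof (intro sum_mono)
      fix \<alpha> assume "\<alpha> \<in> {..<d}"
      then have "\<bar>v $ \<alpha> - w $ \<alpha>\<bar> \<le> 1 / (2 * r * (d + 1))" using close by (simp add: less_imp_le)
      then show "\<bar>(v $ \<alpha> - w $ \<alpha>) * e \<alpha> z\<bar> \<le> 1 / (2 * r * (d + 1)) * 2"
        unfolding abs_mult using abs_e_le r_pos by (intro mult_mono) auto
    qed
    also have "\<dots> = (d / (d + 1)) / r" using r_pos by (simp add: divide_simps)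
    finally have "\<bar>x z - y z\<bar> * r \<le> d / (d + 1)"
      using r_pos by (subst (asm) pos_le_divide_eq) auto
    also have "\<dots> < 1" by simp
    finally have lt: "\<bar>(x z - y z) * r\<bar> < 1" using r_pos by (simp add: abs_mult)
    have int: "f z * r \<in> \<int>" if "admissible a b f" for a b f
    proof -
      have "(f z - carry a b z / r) * r \<in> \<int>"
        using that z by (intro Ints_mult) (auto simp: admissible_def)
      then have "(f z - carry a b z / r) * r + carry a b z \<in> \<int>" by (intro Ints_add) auto
      then show ?thesis using r_pos by (simp add: algebra_simps)
    qed
    have "(x z - y z) * r \<in> \<int>"
      using int[OF gx(2)] int[OF hy(2)] by (simp add: left_diff_distrib)
    then have "(x z - y z) * r = 0" using lt by (rule Ints_nonzero_abs_less1)
    then show ?thesis using r_pos by simp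
  qed
  let ?s = "shift (- a) (- b)"
  have inv: "inv\<^bsub>Iso d\<^esub> (A, v) \<otimes>\<^bsub>Iso d\<^esub> (B, w) = motion (- a + a') (- b + b') (\<lambda>z. - x (?s z) + y (?s z))"
    unfolding gx(1) hy(1) using sp by (simp add: motion_inverse motion_mult)
  have "admissible (- a + a') (- b + b') (\<lambda>z. - x (?s z) + y (?s z))"
    by (rule admissible_add[OF admissible_inverse[OF gx(2)] hy(2)])
  moreover have "coords (\<lambda>z. - x (?s z) + y (?s z)) = 0\<^sub>v d"
    unfolding coords_zero[symmetric] by (rule coords_cong) (simp add: xy shift_in_X)
  ultimately have "inv\<^bsub>Iso d\<^esub> (A, v) \<otimes>\<^bsub>Iso d\<^esub> (B, w) = \<one>\<^bsub>Iso d\<^esub>"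
    unfolding inv by (rule admissible_motion_one(3))
  moreover have c: "(A, v) \<in> carrier (Iso d)" "(B, w) \<in> carrier (Iso d)"
    by (simp_all only: gx hy motion_carrier)
  ultimately have "inv\<^bsub>Iso d\<^esub> (B, w) = inv\<^bsub>Iso d\<^esub> (A, v)"
    by (intro inv_equality inv_closed)
  then show ?thesis using inv_inv[OF c(1)] inv_inv[OF c(2)] by (simp only:)
qed

lemma crystallographic_H: "crystallographic d H"
proof (rule crystallographicI[OF subgroup_H lattice_cocompact])
  show "0 < 1 / (2 * of_int r * (real d + 1))" using r_pos by simp
qed (use lattice_separated in \<open>simp_all add: add.commute\<close>)

section \<open>Torsion-freeness\<close>

lemma motion_pow:
  assumes adm: "admissible a b x"
  shows "\<exists>y. motion a b x [^]\<^bsub>Iso d\<^esub> k = motion (int k * a) (int k * b) y \<and>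
    admissible (int k * a) (int k * b) y \<and> (\<forall>z\<in>X. shift a b z = z \<longrightarrow> y z = k * x z)"
proof (induction k)
  case 0
  have "motion 0 0 (\<lambda>z. 0) = \<one>\<^bsub>Iso d\<^esub>" by (rule motion_one) auto
  then show ?case
    using admissible_zero by (intro exI[of _ "\<lambda>z. 0"]) simp
next
  case (Suc k)
  interpret group "Iso d" by (rule group_Iso)
  obtain y where y: "motion a b x [^]\<^bsub>Iso d\<^esub> k = motion (int k * a) (int k * b) y"
    "admissible (int k * a) (int k * b) y" "\<forall>z\<in>X. shift a b z = z \<longrightarrow> y z = k * x z"
    using Suc by blast
  \<comment> \<open>The new factor goes on the left, so \<open>y\<close> is evaluated at the shifted
    point, which is the same point when the shift fixes it.\<close>
  have "motion a b x [^]\<^bsub>Iso d\<^esub> Suc k = motion a b x \<otimes>\<^bsub>Iso d\<^esub> motion (int k * a) (int k * b) y"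
    by (simp only: nat_pow_Suc2[OF motion_carrier] y(1))
  also have "\<dots> = motion (a + int k * a) (b + int k * b) (\<lambda>z. x z + y (shift a b z))"
    using y(2) by (simp add: motion_mult admissible_def)
  finally have "motion a b x [^]\<^bsub>Iso d\<^esub> Suc k =
      motion (int (Suc k) * a) (int (Suc k) * b) (\<lambda>z. x z + y (shift a b z))"
    by (simp add: algebra_simps)
  moreover have "admissible (int (Suc k) * a) (int (Suc k) * b) (\<lambda>z. x z + y (shift a b z))"
    using admissible_add[OF adm y(2)] by (simp add: algebra_simps)
  ultimately show ?case
    using y(3) by (intro exI conjI) (auto simp: algebra_simps)
qed

text \<open>If \<open>g\<close> has prime order then its first parameter is divisible by \<open>m\<close>, so \<open>g\<close> fixes the
  coordinates with first index \<open>m\<close>, where it acts as a translation congruent to \<open>b / r\<close> modulo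
  \<open>\<int>\<close>.\<close>

lemma motion_prime_power_one:
  fixes p :: nat
  assumes adm: "admissible a b x" and p: "prime p"
    and one: "motion a b x [^]\<^bsub>Iso d\<^esub> p = \<one>\<^bsub>Iso d\<^esub>"
  shows "motion a b x = \<one>\<^bsub>Iso d\<^esub>"
proof -
  obtain y where y: "motion a b x [^]\<^bsub>Iso d\<^esub> p = motion (int p * a) (int p * b) y"
    "admissible (int p * a) (int p * b) y" "\<forall>z\<in>X. shift a b z = z \<longrightarrow> y z = p * x z"
    using motion_pow[OF adm] by blast
  have y0: "coords y = 0\<^sub>v d" using y(1) one by (simp add: motion_def Iso_def)
  have dvd: "m * r dvd int p * a" using admissible_motion_one(1)[OF y(2) y0] .
  \<comment> \<open>At a fixed point of the shift the power translates by
    \<open>p * x z\<close>.\<close>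
  have fixed: "x z = 0" if "z \<in> X" "shift a b z = z" for z
  proof -
    have "y z = 0"
      using coords_eqD[of y "\<lambda>z. 0" z] y(2) y0 that
      by (simp add: admissible_def coords_zero spanned_zero)
    then show ?thesis using y(3) that p by (auto simp: prime_gt_0_nat)
  qed
  have pp: "prime (int p)" using p by simp
  have m: "m dvd a"
  proof (cases "int p dvd r")
    case True
    \<comment> \<open>Cancelling \<open>p\<close> leaves \<open>m * (r / p)\<close> as a divisor of
      \<open>a\<close>.\<close>
    then obtain s where "r = int p * s" by (elim dvdE)
    then have "int p * (m * s) dvd int p * a" using dvd by (simp add: mult_ac)
    then have "m * s dvd a" using pp by (simp add: dvd_mult_cancel_left)
    then show ?thesis by (rule dvd_mult_left)
  next
    case False
    \<comment> \<open>By the condition on primes, \<open>p\<close> divides neither factor of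
      \<open>m * r\<close>.\<close>
    then have "\<not> int p dvd m * r"
      using prime_dvd_r[OF pp] pp by (auto simp: prime_dvd_mult_iff)
    then have "coprime (m * r) (int p)" using pp by (metis coprime_commute prime_imp_coprime)
    then have "m * r dvd a" using dvd by (simp add: coprime_dvd_mult_right_iff)
    then show ?thesis by (rule dvd_mult_left)
  qed
  have X: "(m, 0) \<in> X" using m_pos r_pos by (auto simp: X_def)
  \<comment> \<open>As \<open>r\<close> divides \<open>m\<close>, it divides \<open>a\<close>, so
    the last fibre is fixed, and the carry there is \<open>b\<close>. Then the shift fixes all of
    \<open>X\<close>, and \<open>x\<close> vanishes everywhere.\<close>
  have "shift a b (m, 0) = (m, 0)"
    using dvd_imp_mod_0[OF dvd_trans[OF r_dvd_m m]] by (simp add: shift_def)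
  then have "r dvd carry a b (m, 0)" by (intro r_dvd_carry[OF adm X] fixed X)
  then have "r dvd b" by (simp add: carry_def)
  then show ?thesis using m by (intro motion_one fixed shift_ident)
qed

text \<open>Strong induction on the exponent: a prime factor is split off, and the power with the
  remaining exponent is trivial by the prime case.\<close>

lemma motion_power_one:
  fixes k :: nat
  assumes "g \<in> H" "0 < k" "g [^]\<^bsub>Iso d\<^esub> k = \<one>\<^bsub>Iso d\<^esub>"
  shows "g = \<one>\<^bsub>Iso d\<^esub>"
  using assms(2,3)
proof (induction k rule: less_induct)
  case (less k)
  interpret group "Iso d" by (rule group_Iso)
  have g: "g \<in> carrier (Iso d)" using assms(1) subgroup.subset[OF subgroup_H] by auto
  show ?case
  proof (cases "k = 1")
    case True
    then show ?thesis using less.prems g by simp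
  next
    case False
    then obtain p where p: "prime p" "p dvd k" using prime_factor_nat by blast
    then obtain l where k: "k = l * p" by (metis dvdE mult.commute)
    have l: "0 < l" "l < k" using less.prems(1) p(1) prime_gt_1_nat[OF p(1)] by (auto simp: k)
    obtain a b x where gx: "g = motion a b x" "admissible a b x" using assms(1) by (auto simp: H_def)
    obtain y where y: "g [^]\<^bsub>Iso d\<^esub> l = motion (int l * a) (int l * b) y"
      "admissible (int l * a) (int l * b) y" using motion_pow[OF gx(2)] gx(1) by blast
    have "(g [^]\<^bsub>Iso d\<^esub> l) [^]\<^bsub>Iso d\<^esub> p = \<one>\<^bsub>Iso d\<^esub>"
      using less.prems(2) g by (simp add: nat_pow_pow k)
    then have "g [^]\<^bsub>Iso d\<^esub> l = \<one>\<^bsub>Iso d\<^esub>"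
      unfolding y(1) by (rule motion_prime_power_one[OF y(2) p(1)])
    then show ?thesis using less.IH l by blast
  qed
qed

lemma Bieberbach_H: "Bieberbach ((Iso d)\<lparr>carrier := H\<rparr>)"
proof -
  interpret group "Iso d" by (rule group_Iso)
  have "torsion_free ((Iso d)\<lparr>carrier := H\<rparr>)"
    unfolding torsion_free_def by (auto simp: nat_pow_consistent[symmetric] intro: motion_power_one)
  then show ?thesis unfolding Bieberbach_def using crystallographic_H by blast
qed

end


section \<open>Transversals and products of conjugates\<close>

text \<open>\<open>S\<close> holds one representative of each right coset of the cyclic group
  generated by \<open>f\<close>, and an invariant function is constant on these cosets.
  \<open>S\<close> is chosen before the function, so that one set serves all coordinates
  later.\<close>

lemma (in group) sum_cyclic_transversal:
  assumes fin: "finite (carrier G)" and f: "f \<in> carrier G"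
  shows "\<exists>S\<subseteq>carrier G. ord f * card S = Coset.order G \<and>
    (\<forall>\<phi> :: 'a \<Rightarrow> real. (\<forall>c\<in>carrier G. \<phi> (f \<otimes> c) = \<phi> c) \<longrightarrow>
       (\<Sum>c\<in>carrier G. \<phi> c) = ord f * (\<Sum>c\<in>S. \<phi> c))"
proof -
  define W where "W = generate G {f}"
  have W: "subgroup W G" using f by (simp add: W_def generate_is_subgroup)
  have cardW: "card W = ord f" by (simp add: W_def generate_pow_card[OF f])
  have W_pow: "W = {f [^] k |k. k \<in> (UNIV :: nat set)}"
    by (simp add: W_def generate_pow_on_finite_carrier[OF fin f])
  define rep where "rep C = (SOME c. c \<in> C)" for C :: "'a set"
  have rep: "rep C \<in> C" if C: "C \<in> rcosets W" for C
  proof -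
    obtain x where "x \<in> C" using C rcos_self[OF _ W] by (auto simp: RCOSETS_def)
    then show ?thesis unfolding rep_def by (rule someI)
  qed
  have part: "\<Union>(rcosets W) = carrier G" by (rule rcosets_part_G[OF W])
  have disj: "pairwise disjnt (rcosets W)" by (rule rcos_disjoint[OF W])
  have inj: "inj_on rep (rcosets W)"
  proof (rule inj_onI)
    fix C D assume "C \<in> rcosets W" "D \<in> rcosets W" "rep C = rep D"
    then show "C = D" using rep disj unfolding pairwise_def disjnt_iff by metis
  qed
  have sum: "(\<Sum>c\<in>carrier G. \<phi> c) = ord f * (\<Sum>c\<in>rep ` (rcosets W). \<phi> c)"
    if inv: "\<forall>c\<in>carrier G. \<phi> (f \<otimes> c) = \<phi> c" for \<phi> :: "'a \<Rightarrow> real"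
  proof -
    have pow: "\<phi> (f [^] k \<otimes> c) = \<phi> c" if "c \<in> carrier G" for c and k :: nat
    proof (induction k)
      case (Suc k)
      have "f [^] Suc k \<otimes> c = f \<otimes> (f [^] k \<otimes> c)"
        using f that by (simp only: nat_pow_Suc2 m_assoc nat_pow_closed)
      then show ?case using Suc inv f that by simp
    qed (use that in simp)
    have const: "\<phi> c = \<phi> (rep C)" if C: "C \<in> rcosets W" and c: "c \<in> C" for C c
    proof -
      obtain x where x: "x \<in> carrier G" "C = W #> x" using C by (auto simp: RCOSETS_def)
      have "\<phi> y = \<phi> x" if y: "y \<in> C" for y
      proof -
        obtain k :: nat where "y = f [^] k \<otimes> x" using y x W_pow by (auto simp: r_coset_def)
        then show ?thesis using pow x by simp
      qed
      then show ?thesis using c rep[OF C] by metis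
    qed
    have finC: "finite C" if "C \<in> rcosets W" for C
      using part fin that by (metis Union_upper finite_subset)
    have "(\<Sum>c\<in>carrier G. \<phi> c) = (\<Sum>C\<in>rcosets W. \<Sum>c\<in>C. \<phi> c)"
      unfolding part[symmetric] using finC disj
      by (subst sum.Union_disjoint) (auto simp: pairwise_def disjnt_def)
    also have "\<dots> = (\<Sum>C\<in>rcosets W. ord f * \<phi> (rep C))"
    proof (rule sum.cong[OF refl])
      fix C assume C: "C \<in> rcosets W"
      have "card C = ord f"
        using card_rcosets_equal[OF C subgroup.subset[OF W]] cardW by simp
      moreover have "(\<Sum>c\<in>C. \<phi> c) = (\<Sum>c\<in>C. \<phi> (rep C))" using const[OF C] by (rule sum.cong[OF refl])
      ultimately show "(\<Sum>c\<in>C. \<phi> c) = ord f * \<phi> (rep C)" by simp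
    qed
    also have "\<dots> = ord f * (\<Sum>c\<in>rep ` (rcosets W). \<phi> c)"
      by (simp add: sum.reindex[OF inj] sum_distrib_left)
    finally show ?thesis .
  qed
  have "ord f * card (rep ` (rcosets W)) = Coset.order G"
    using lagrange_finite[OF fin W] by (simp add: card_image[OF inj] cardW mult.commute)
  moreover have "rep ` (rcosets W) \<subseteq> carrier G" using rep part by blast
  ultimately show ?thesis using sum by blast
qed

section \<open>Words over a conjugacy class\<close>

context group
begin

lemma foldr_mult_append:
  assumes "set xs \<subseteq> carrier G" "set ys \<subseteq> carrier G"
  shows "foldr (\<otimes>) (xs @ ys) \<one> = foldr (\<otimes>) xs \<one> \<otimes> foldr (\<otimes>) ys \<one>"
proof -
  have closed: "foldr (\<otimes>) zs \<one> \<in> carrier G" if "set zs \<subseteq> carrier G" for zs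
    using that by (induction zs) auto
  show ?thesis using assms(1) by (induction xs) (auto simp: m_assoc closed assms(2))
qed

lemma set_power_mult:
  assumes "C \<subseteq> carrier G" "x \<in> set_power G C i" "y \<in> set_power G C j"
  shows "x \<otimes> y \<in> set_power G C (i + j)"
proof -
  obtain xs ys where "x = foldr (\<otimes>) xs \<one>" "length xs = i" "set xs \<subseteq> C"
    "y = foldr (\<otimes>) ys \<one>" "length ys = j" "set ys \<subseteq> C"
    using assms(2,3) by (auto simp: set_power_def)
  then show ?thesis
    using assms(1) unfolding set_power_def
    by (intro CollectI exI[of _ "xs @ ys"]) (simp del: foldr_append add: foldr_mult_append)
qed

lemma set_power_0: "\<one> \<in> set_power G C 0"
  by (auto simp: set_power_def)

lemma pow_in_set_power:
  assumes "C \<subseteq> carrier G" "c \<in> C"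
  shows "c [^] k \<in> set_power G C k"
proof (induction k)
  case 0
  then show ?case by (simp add: set_power_0)
next
  case (Suc k)
  have "foldr (\<otimes>) [c] \<one> \<in> set_power G C 1"
    unfolding set_power_def using assms(2) by (intro CollectI exI[of _ "[c]"]) auto
  then have "c \<in> set_power G C 1" using assms by auto
  then have "c [^] k \<otimes> c \<in> set_power G C (k + 1)" by (rule set_power_mult[OF assms(1) Suc])
  then show ?case by simp
qed

lemma conjugate_pow:
  assumes "h \<in> carrier G" "g \<in> carrier G"
  shows "(h \<otimes> g \<otimes> inv h) [^] (k::nat) = h \<otimes> g [^] k \<otimes> inv h"
proof (induction k)
  case (Suc k)
  have "(h \<otimes> g [^] k \<otimes> inv h) \<otimes> (h \<otimes> g \<otimes> inv h) = h \<otimes> g [^] k \<otimes> (inv h \<otimes> h) \<otimes> g \<otimes> inv h"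
    using assms by (simp only: m_assoc m_closed inv_closed nat_pow_closed)
  then show ?case using Suc assms by (simp add: m_assoc)
qed (use assms in simp)

end


section \<open>The generalized exponent\<close>

context twisted_lattice
begin

section \<open>Sums over the holonomy group\<close>

lemma shift_cong:
  assumes "m dvd a - a'" "r dvd b - b'" "z \<in> X"
  shows "shift a b z = shift a' b' z"
  using shift_shift[of "a - a'" "b - b'" a' b' z] shift_ident[OF assms(1,2) shift_in_X[OF assms(3)]]
  by simp

lemma motion_eqI:
  assumes "m dvd a - a'" "r dvd b - b'" "\<And>z. z \<in> X \<Longrightarrow> x z = x' z"
  shows "motion a b x = motion a' b' x'"
  using assms by (auto simp: motion_def intro!: compose_mat_cong coords_cong shift_cong)

lemma spanned_sum:
  assumes "\<And>i. i \<in> S \<Longrightarrow> spanned (y i)"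
  shows "spanned (\<lambda>z. \<Sum>i\<in>S. y i z)"
  unfolding spanned_iff
proof
  fix j assume "j \<in> {0..m}"
  then have "(\<Sum>k\<in>{0..<r}. y i (j, k)) = 0" if "i \<in> S" for i
    using assms[OF that] by (simp add: spanned_iff)
  then show "(\<Sum>k\<in>{0..<r}. \<Sum>i\<in>S. y i (j, k)) = 0"
    by (subst sum.swap) simp
qed

text \<open>The sum over all shifts is itself invariant under shifts, some of which rotate a given
  fibre transitively. So it is constant on fibres, and the zero fibre sum makes it vanish.\<close>

lemma sum_all_shifts:
  assumes u: "spanned u" and z: "z \<in> X"
  shows "(\<Sum>(s, t)\<in>{0..<m} \<times> {0..<r}. u (shift s t z)) = 0"
proof -
  define W where "W z = (\<Sum>(s, t)\<in>{0..<m} \<times> {0..<r}. u (shift s t z))" for z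
  have inv: "W (shift a b w) = W w" if w: "w \<in> X" for a b w
  proof -
    have bij: "bij_betw (map_prod (\<lambda>s. (s + a) mod m) (\<lambda>t. (t + b) mod r))
        ({0..<m} \<times> {0..<r}) ({0..<m} \<times> {0..<r})"
      by (intro bij_betw_map_prod bij_betw_add_mod m_pos r_pos)
    have "W (shift a b w) = (\<Sum>(s, t)\<in>{0..<m} \<times> {0..<r}. u (shift ((s + a) mod m) ((t + b) mod r) w))"
      unfolding W_def shift_shift
      by (intro sum.cong refl) (auto intro!: arg_cong[of _ _ u] shift_cong w
          simp: mod_eq_dvd_iff[symmetric])
    also have "\<dots> = W w"
      unfolding W_def using sum.reindex_bij_betw[OF bij, of "\<lambda>(s, t). u (shift s t w)"]
      by (simp add: map_prod_def split_def)
    finally show ?thesis .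
  qed
  obtain j k where jk: "z = (j, k)" "j \<in> {0..m}" "k \<in> {0..<r}" using z by (auto simp: X_def)
  have const: "W (j, l) = W (j, 0)" if l: "l \<in> {0..<r}" for l
  proof -
    \<comment> \<open>On the last fibre it is the first parameter that turns the points.\<close>
    have "(j, l) = (if j < m then shift 0 l (j, 0) else shift l 0 (j, 0))"
      using jk l by (auto simp: shift_def)
    moreover have "(j, 0) \<in> X" using jk r_pos by (simp add: X_def)
    ultimately show ?thesis using inv by (metis (full_types))
  qed
  have "spanned W"
    unfolding W_def split_def by (intro spanned_sum spanned_shift u)
  then have "(\<Sum>l\<in>{0..<r}. W (j, l)) = 0" using jk by (simp add: spanned_iff)
  moreover have "(\<Sum>l\<in>{0..<r}. W (j, l)) = (\<Sum>l\<in>{0..<r}. W (j, 0))"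
    using const by (rule sum.cong[OF refl])
  ultimately have "W (j, 0) = 0" using r_pos by simp
  then have "W z = 0" using const jk by simp
  then show ?thesis by (simp add: W_def)
qed

section \<open>The upper bound for the exponent\<close>

definition G :: "euclidean_motion monoid" where
  "G = (Iso d)\<lparr>carrier := H\<rparr>"

lemma group_G: "group G"
  unfolding G_def by (rule subgroup.subgroup_is_group[OF subgroup_H group_Iso])

lemma carrier_G: "carrier G = H"
  and mult_G: "x \<otimes>\<^bsub>G\<^esub> y = x \<otimes>\<^bsub>Iso d\<^esub> y"
  and one_G: "\<one>\<^bsub>G\<^esub> = \<one>\<^bsub>Iso d\<^esub>"
  by (simp_all add: G_def)

lemma inv_G: "x \<in> H \<Longrightarrow> inv\<^bsub>G\<^esub> x = inv\<^bsub>Iso d\<^esub> x"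
  unfolding G_def using group.m_inv_consistent[OF group_Iso subgroup_H] .

lemma pow_G: "x [^]\<^bsub>G\<^esub> (k :: nat) = x [^]\<^bsub>Iso d\<^esub> k"
  unfolding G_def by (rule monoid.nat_pow_consistent[symmetric]) (simp add: group.is_monoid group_Iso)

lemma motion_in_H: "admissible a b x \<Longrightarrow> motion a b x \<in> H"
  by (auto simp: H_def)

text \<open>Conjugation sees only the linear part: moving the translation past the conjugating
  element composes \<open>u\<close> with its shift.\<close>

lemma conjugate_translation:
  assumes u: "spanned u" and y: "admissible s t y" and mem: "motion 0 0 u \<in> H"
  shows "motion s t y \<otimes>\<^bsub>G\<^esub> motion 0 0 u \<otimes>\<^bsub>G\<^esub> inv\<^bsub>G\<^esub> motion s t y
    = motion 0 0 (\<lambda>z. u (shift s t z))"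
proof -
  interpret Iso: group "Iso d" by (rule group_Iso)
  let ?h = "motion s t y" and ?u' = "motion 0 0 (\<lambda>z. u (shift s t z))"
  have sy: "spanned y" using y by (simp add: admissible_def)
  have "?h \<otimes>\<^bsub>Iso d\<^esub> motion 0 0 u = motion s t (\<lambda>z. y z + u (shift s t z))"
    using u by (simp add: motion_mult)
  also have "\<dots> = ?u' \<otimes>\<^bsub>Iso d\<^esub> ?h"
    using sy by (simp add: motion_mult) (rule motion_eqI; simp add: shift_ident)
  finally have "?h \<otimes>\<^bsub>Iso d\<^esub> motion 0 0 u = ?u' \<otimes>\<^bsub>Iso d\<^esub> ?h" .
  then show ?thesis
    using y motion_in_H[OF y]
    by (simp add: mult_G inv_G Iso.m_assoc motion_carrier)
qed

lemma one_in_class_power: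
  assumes g: "g \<in> carrier G"
  shows "\<one>\<^bsub>G\<^esub> \<in> set_power G (conjugacy_class G g) (nat (m * r))"
proof -
  interpret G: group G by (rule group_G)
  let ?C = "conjugacy_class G g"
  have C: "?C \<subseteq> carrier G" using g by (auto simp: conjugacy_class_def)
  obtain a b x where gx: "g = motion a b x" "admissible a b x"
    using g by (auto simp: carrier_G H_def)
  \<comment> \<open>\<open>F\<close> models the holonomy group by pairs of residues, and
    \<open>f\<close> is the holonomy of \<open>g\<close>.\<close>
  define F where "F = integer_mod_group (nat m) \<times>\<times> integer_mod_group (nat r)"
  define f where "f = (a mod m, b mod r)"
  interpret F: group F by (simp add: F_def DirProd_group)
  have carrier_F: "carrier F = {0..<m} \<times> {0..<r}"
    using m_pos r_pos by (simp add: F_def carrier_integer_mod_group)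
  have fin: "finite (carrier F)" and f: "f \<in> carrier F"
    using m_pos r_pos by (auto simp: carrier_F f_def)
  have mult_F: "f \<otimes>\<^bsub>F\<^esub> (s, t) = ((a mod m + s) mod m, (b mod r + t) mod r)" for s t
    using m_pos r_pos by (simp add: F_def f_def)
  define q where "q = F.ord f"
  obtain S where S: "S \<subseteq> carrier F" "q * card S = Coset.order F"
    and sum_S: "\<And>\<phi> :: int \<times> int \<Rightarrow> real. (\<forall>c\<in>carrier F. \<phi> (f \<otimes>\<^bsub>F\<^esub> c) = \<phi> c) \<Longrightarrow>
      (\<Sum>c\<in>carrier F. \<phi> c) = q * (\<Sum>c\<in>S. \<phi> c)"
    using F.sum_cyclic_transversal[OF fin f] unfolding q_def by blast
  have order_F: "Coset.order F = nat (m * r)"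
    using m_pos r_pos by (simp add: Coset.order_def carrier_F nat_mult_distrib)
  have q_pos: "0 < q" using S(2) order_F mult_pos_pos[OF m_pos r_pos] by (cases q) auto
  have pow_F: "f [^]\<^bsub>F\<^esub> k = ((int k * a) mod m, (int k * b) mod r)" for k :: nat
  proof (induction k)
    case 0
    then show ?case by (simp add: F_def)
  next
    case (Suc k)
    have "f [^]\<^bsub>F\<^esub> Suc k = f \<otimes>\<^bsub>F\<^esub> f [^]\<^bsub>F\<^esub> k" by (rule F.nat_pow_Suc2[OF f])
    then show ?case by (simp add: Suc mult_F mod_simps algebra_simps)
  qed
  have "f [^]\<^bsub>F\<^esub> q = \<one>\<^bsub>F\<^esub>" unfolding q_def by (rule F.pow_ord_eq_1[OF f])
  \<comment> \<open>So the \<open>q\<close>-th power of \<open>g\<close> has a trivial shift and is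
    the translation by \<open>u\<close> below.\<close>
  then have q: "m dvd int q * a" "r dvd int q * b"
    unfolding pow_F by (simp_all add: F_def mod_eq_0_iff_dvd)
  obtain u where u: "g [^]\<^bsub>G\<^esub> q = motion (int q * a) (int q * b) u"
    "admissible (int q * a) (int q * b) u"
    using motion_pow[OF gx(2)] by (auto simp: gx(1) pow_G)
  have su: "spanned u" and sx: "spanned x" using u gx by (auto simp: admissible_def)
  have u0: "g [^]\<^bsub>G\<^esub> q = motion 0 0 u" unfolding u(1) using q by (intro motion_eqI) auto
  have umem: "motion 0 0 u \<in> H" unfolding u0[symmetric] using g by (simp flip: carrier_G)
  \<comment> \<open>The \<open>q\<close>-th power of \<open>g\<close> commutes with
    \<open>g\<close>, which makes \<open>u\<close> invariant under the shift of
    \<open>g\<close>.\<close>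
  have u_inv: "u (shift a b z) = u z" if z: "z \<in> X" for z
  proof -
    have "g \<otimes>\<^bsub>G\<^esub> g [^]\<^bsub>G\<^esub> q = g [^]\<^bsub>G\<^esub> q \<otimes>\<^bsub>G\<^esub> g"
      using G.nat_pow_Suc2[OF g, of q] by simp
    then have "motion a b x \<otimes>\<^bsub>Iso d\<^esub> motion 0 0 u = motion 0 0 u \<otimes>\<^bsub>Iso d\<^esub> motion a b x"
      unfolding u0 mult_G by (simp only: gx(1)[symmetric])
    then have "motion a b (\<lambda>z. x z + u (shift a b z)) = motion a b (\<lambda>z. u z + x (shift 0 0 z))"
      using su sx by (simp add: motion_mult)
    then have "coords (\<lambda>z. x z + u (shift a b z)) = coords (\<lambda>z. u z + x (shift 0 0 z))"
      by (simp add: motion_def)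
    then have "x z + u (shift a b z) = u z + x (shift 0 0 z)"
      by (rule coords_eqD) (intro spanned_add spanned_shift su sx z)+
    then show ?thesis using z by (simp add: shift_ident)
  qed
  \<comment> \<open>The sum over all of \<open>F\<close> vanishes, and by invariance under
    \<open>f\<close> it is \<open>q\<close> times the sum over \<open>S\<close>.\<close>
  have sum_zero: "(\<Sum>(s, t)\<in>S. u (shift s t z)) = 0" if z: "z \<in> X" for z
  proof -
    have "(\<Sum>c\<in>carrier F. (\<lambda>(s, t). u (shift s t z)) c) = q * (\<Sum>c\<in>S. (\<lambda>(s, t). u (shift s t z)) c)"
    proof (rule sum_S, rule ballI)
      fix c assume "c \<in> carrier F"
      obtain s t where c: "c = (s, t)" by (cases c)
      have "shift ((a mod m + s) mod m) ((b mod r + t) mod r) z = shift a b (shift s t z)"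
        unfolding shift_shift by (rule shift_cong[OF _ _ z])
          (simp_all add: mod_eq_dvd_iff[symmetric] mod_simps)
      then show "(\<lambda>(s, t). u (shift s t z)) (f \<otimes>\<^bsub>F\<^esub> c) = (\<lambda>(s, t). u (shift s t z)) c"
        using u_inv[OF shift_in_X[OF z]] by (simp add: c mult_F)
    qed
    then show ?thesis using sum_all_shifts[OF su z] q_pos by (simp add: carrier_F)
  qed
  \<comment> \<open>Each \<open>c\<close> in \<open>T\<close> contributes the \<open>q\<close>-th
    power of a conjugate of \<open>g\<close> by an element with holonomy \<open>c\<close>, and
    translations add up. For \<open>T = S\<close> the number of factors is the order of
    \<open>F\<close>, which is \<open>m * r\<close>.\<close>
  have "motion 0 0 (\<lambda>z. \<Sum>(s, t)\<in>T. u (shift s t z)) \<in> set_power G ?C (q * card T)"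
    if "finite T" for T :: "(int \<times> int) set"
    using that
  proof induction
    case empty
    have "motion 0 0 (\<lambda>z. 0) = \<one>\<^bsub>G\<^esub>" unfolding one_G by (rule motion_one) auto
    then show ?case using G.set_power_0 by simp
  next
    case (insert c T)
    obtain s t where c: "c = (s, t)" by (cases c)
    obtain y where y: "admissible s t y" using admissible_exists by blast
    let ?h = "motion s t y"
    have h: "?h \<in> carrier G" using motion_in_H[OF y] by (simp add: carrier_G)
    have "?h \<otimes>\<^bsub>G\<^esub> g \<otimes>\<^bsub>G\<^esub> inv\<^bsub>G\<^esub> ?h \<in> ?C" unfolding conjugacy_class_def using h by blast
    then have "(?h \<otimes>\<^bsub>G\<^esub> g \<otimes>\<^bsub>G\<^esub> inv\<^bsub>G\<^esub> ?h) [^]\<^bsub>G\<^esub> q \<in> set_power G ?C q"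
      by (rule G.pow_in_set_power[OF C])
    then have "motion 0 0 (\<lambda>z. u (shift s t z)) \<in> set_power G ?C q"
      by (simp only: G.conjugate_pow[OF h g] u0 conjugate_translation[OF su y umem])
    then have "motion 0 0 (\<lambda>z. u (shift s t z)) \<otimes>\<^bsub>G\<^esub> motion 0 0 (\<lambda>z. \<Sum>(s, t)\<in>T. u (shift s t z))
        \<in> set_power G ?C (q + q * card T)"
      by (rule G.set_power_mult[OF C _ insert.IH])
    moreover have "spanned (\<lambda>z. \<Sum>(s, t)\<in>T. u (shift s t z))"
      unfolding split_def by (intro spanned_sum spanned_shift su)
    then have "motion 0 0 (\<lambda>z. u (shift s t z)) \<otimes>\<^bsub>G\<^esub> motion 0 0 (\<lambda>z. \<Sum>(s, t)\<in>T. u (shift s t z))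
        = motion 0 0 (\<lambda>z. \<Sum>(s, t)\<in>insert c T. u (shift s t z))"
      unfolding mult_G using insert.hyps
      by (subst motion_mult) (auto intro!: motion_eqI simp: c shift_ident)
    ultimately show ?case using insert.hyps by simp
  qed
  from this[of S] have "motion 0 0 (\<lambda>z. \<Sum>(s, t)\<in>S. u (shift s t z)) \<in> set_power G ?C (nat (m * r))"
    using S order_F fin finite_subset by metis
  moreover have "motion 0 0 (\<lambda>z. \<Sum>(s, t)\<in>S. u (shift s t z)) = \<one>\<^bsub>G\<^esub>"
    unfolding one_G by (rule motion_one) (auto simp: sum_zero)
  ultimately show ?thesis by simp
qed

section \<open>The lower bound for the exponent\<close>

lemma annihilates_classes_lower_bound:
  assumes k: "annihilates_classes G k"
  shows "nat (m * r) \<le> k"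
proof -
  interpret G: group G by (rule group_G)
  interpret Iso: group "Iso d" by (rule group_Iso)
  \<comment> \<open>In words over the class of an element with parameters 1 and 0, the first
    parameter counts the letters.\<close>
  obtain x where x: "admissible 1 0 x" using admissible_exists by blast
  let ?g = "motion 1 0 x"
  have g: "?g \<in> carrier G" using motion_in_H[OF x] by (simp add: carrier_G)
  have conj: "\<exists>y. c = motion 1 0 y \<and> admissible 1 0 y" if c: "c \<in> conjugacy_class G ?g" for c
  proof -
    obtain h where h: "h \<in> H" "c = h \<otimes>\<^bsub>Iso d\<^esub> ?g \<otimes>\<^bsub>Iso d\<^esub> inv\<^bsub>Iso d\<^esub> h"
      using c by (auto simp: conjugacy_class_def carrier_G mult_G inv_G)
    obtain s t w where w: "h = motion s t w" "admissible s t w" using h by (auto simp: H_def)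
    \<comment> \<open>Conjugation adds \<open>s\<close> and then \<open>- s\<close>, so the
      parameters return to 1 and 0.\<close>
    let ?y = "\<lambda>z. w z + x (shift s t z)"
    let ?v = "\<lambda>z. - w (shift (- s) (- t) z)"
    have 1: "admissible (s + 1) (t + 0) ?y" by (rule admissible_add[OF w(2) x])
    have 2: "admissible (- s) (- t) ?v" by (rule admissible_inverse[OF w(2)])
    have "c = motion (s + 1) (t + 0) ?y \<otimes>\<^bsub>Iso d\<^esub> motion (- s) (- t) ?v"
      using x w(2) unfolding h(2) w(1)
      by (simp only: motion_mult[of x] motion_inverse[of w] admissible_def)
    also have "\<dots> = motion (s + 1 + - s) (t + 0 + - t) (\<lambda>z. ?y z + ?v (shift (s + 1) (t + 0) z))"
      using 2 by (intro motion_mult) (simp add: admissible_def)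
    finally have "c = motion 1 0 (\<lambda>z. ?y z + ?v (shift (s + 1) (t + 0) z))" by simp
    moreover have "admissible 1 0 (\<lambda>z. ?y z + ?v (shift (s + 1) (t + 0) z))"
      using admissible_add[OF 1 2] by simp
    ultimately show ?thesis by blast
  qed
  have prod: "\<exists>y. foldr (\<otimes>\<^bsub>G\<^esub>) cs \<one>\<^bsub>G\<^esub> = motion (int (length cs)) 0 y \<and> admissible (int (length cs)) 0 y"
    if "set cs \<subseteq> conjugacy_class G ?g" for cs
    using that
  proof (induction cs)
    case Nil
    have "motion 0 0 (\<lambda>z. 0) = \<one>\<^bsub>G\<^esub>" unfolding one_G by (rule motion_one) auto
    then show ?case using admissible_zero by (intro exI[of _ "\<lambda>z. 0"]) simp
  next
    case (Cons c cs)
    obtain y where y: "foldr (\<otimes>\<^bsub>G\<^esub>) cs \<one>\<^bsub>G\<^esub> = motion (int (length cs)) 0 y" "admissible (int (length cs)) 0 y"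
      using Cons by auto
    obtain v where v: "c = motion 1 0 v" "admissible 1 0 v"
      using conj[of c] Cons.prems by (auto simp del: split_paired_All)
    have "foldr (\<otimes>\<^bsub>G\<^esub>) (c # cs) \<one>\<^bsub>G\<^esub> = motion (int (length (c # cs))) 0 (\<lambda>z. v z + y (shift 1 0 z))"
      using y(2) by (simp add: y(1) v(1) mult_G motion_mult admissible_def)
    moreover have "admissible (int (length (c # cs))) 0 (\<lambda>z. v z + y (shift 1 0 z))"
      using admissible_add[OF v(2) y(2)] by simp
    ultimately show ?case by blast
  qed
  have "\<one>\<^bsub>G\<^esub> \<in> set_power G (conjugacy_class G ?g) k" and pos: "0 < k"
    using k g by (auto simp: annihilates_classes_def conjugacy_classes_def)
  then obtain cs where cs: "\<one>\<^bsub>G\<^esub> = foldr (\<otimes>\<^bsub>G\<^esub>) cs \<one>\<^bsub>G\<^esub>" "length cs = k"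
    "set cs \<subseteq> conjugacy_class G ?g"
    by (auto simp: set_power_def)
  then obtain y where y: "\<one>\<^bsub>G\<^esub> = motion (int k) 0 y" "admissible (int k) 0 y"
    using prod by metis
  have "coords y = 0\<^sub>v d" using y(1) by (simp add: one_G motion_def Iso_def)
  then have "m * r dvd int k" by (rule admissible_motion_one(1)[OF y(2)])
  then show ?thesis using pos by (auto dest: zdvd_imp_le)
qed

lemma generalized_exponent_G: "generalized_exponent G = nat (m * r)"
proof -
  have "annihilates_classes G (nat (m * r))"
    using one_in_class_power m_pos r_pos
    by (auto simp: annihilates_classes_def conjugacy_classes_def)
  moreover from this have "(LEAST k. annihilates_classes G k) = nat (m * r)"
    by (intro Least_equality annihilates_classes_lower_bound)
  ultimately show ?thesis unfolding generalized_exponent_def by auto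
qed

end

text \<open>Let \<open>r\<close> be the largest number whose square divides \<open>n\<close>, and
  \<open>m = n / r\<close>. If a prime \<open>p\<close> divided \<open>m\<close> but not
  \<open>r\<close>, its square would divide \<open>n\<close> and be coprime to \<open>r\<close>, so
  \<open>p * r\<close> would be a larger choice.\<close>

lemma powerful_square_divisor:
  assumes "powerful n"
  obtains m r :: nat where "n = m * r" "0 < m" "0 < r" "r dvd m"
    "\<And>p. prime p \<Longrightarrow> p dvd m \<Longrightarrow> p dvd r"
proof -
  have n: "0 < n" and pow: "\<And>p. prime p \<Longrightarrow> p dvd n \<Longrightarrow> p\<^sup>2 dvd n"
    using assms by (auto simp: powerful_def)
  define r where "r = (GREATEST r. r\<^sup>2 dvd n)"
  have bound: "s \<le> n" if "s\<^sup>2 dvd n" for s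
  proof -
    have "s \<le> s\<^sup>2" by (simp add: power2_eq_square)
    also have "s\<^sup>2 \<le> n" using that n by (rule dvd_imp_le)
    finally show ?thesis .
  qed
  have r: "r\<^sup>2 dvd n" unfolding r_def by (rule GreatestI_nat[of _ 1 n]) (auto intro: bound)
  have r_max: "s \<le> r" if "s\<^sup>2 dvd n" for s
    unfolding r_def using that by (rule Greatest_le_nat) (auto intro: bound)
  have r_pos: "0 < r" using r_max[of 1] by simp
  obtain l where l: "n = r\<^sup>2 * l" using r by (elim dvdE)
  have primes: "p dvd r" if p: "prime p" "p dvd r * l" for p
  proof (rule ccontr)
    assume np: "\<not> p dvd r"
    have "p\<^sup>2 dvd n" using pow p(1) p(2) by (metis dvd_mult l power2_eq_square mult.assoc)
    moreover have "coprime (p\<^sup>2) (r\<^sup>2)" using p(1) np by (simp add: prime_imp_coprime)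
    ultimately have "(p * r)\<^sup>2 dvd n" unfolding power_mult_distrib using r by (intro divides_mult)
    then have "p * r \<le> r" by (rule r_max)
    then show False using r_pos prime_gt_1_nat[OF p(1)] by simp
  qed
  have "n = (r * l) * r" by (simp add: l power2_eq_square)
  moreover have "0 < r * l" using n l by (cases "r * l") auto
  ultimately show thesis using r_pos primes by (rule that[OF _ _ _ dvd_triv_left])
qed

theorem proposition3p6:
  fixes n :: nat
  assumes "powerful n"
  shows "\<exists>G. Bieberbach G \<and> generalized_exponent G = n"
proof -
  obtain m r :: nat where mr: "n = m * r" "0 < m" "0 < r" "r dvd m"
    "\<And>p. prime p \<Longrightarrow> p dvd m \<Longrightarrow> p dvd r"
    using powerful_square_divisor[OF assms] by blast
  interpret twisted_lattice "int m" "int r"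
  proof
    fix p :: int assume p: "prime p" "p dvd int m"
    \<comment> \<open>Integer primes are nonnegative here, hence images of natural primes.\<close>
    then obtain q where q: "p = int q" by (metis nonneg_int_cases prime_ge_0_int)
    then show "p dvd int r" using mr(5)[of q] p by simp
  qed (use mr in auto)
  have "Bieberbach G" unfolding G_def by (rule Bieberbach_H)
  moreover have "generalized_exponent G = n"
    using generalized_exponent_G mr(1) by (simp flip: of_nat_mult)
  ultimately show ?thesis by blast
qed

end
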